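(* Let $X$ and $Y$ be infinite-dimensional Banach spaces which are uniformly homeomorphic (there is a bijection $U:X\to Y$ with $U$ and $U^{-1}$ uniformly continuous). Then: (i) $\mathrm{Sz}(X)\le\omega_0$ if and only if $\mathrm{Sz}(Y)\le\omega_0$. (ii) There exists a constant $C$ such that if $0\le\tau\le1$, $$\mathrm{Cz}(X,C\tau)\le\mathrm{Cz}(Y,\tau)\le\mathrm{Cz}(X,\tau/C).$$
   Context: For a weak$^*$-compact $K\subset X^*$ and $\epsilon\ge0$, $\iota_\epsilon K$ is $K$ minus the union of all weak$^*$-open $V\subset X^*$ with norm-diameter of $V\cap K$ at most $\epsilon$. Put $\iota_\epsilon^0K=K$, $\iota_\epsilon^{\alpha+1}K=\iota_\epsilon\iota_\epsilon^\alpha K$, and $\iota_\epsilon^\alpha K=\bigcap_{\beta<\alpha}\iota_\epsilon^\beta K$ for limit ordinals $\alpha$. $\mathrm{Sz}(X,\epsilon)$ is the least countable ordinal $\alpha$ with $\iota_\epsilon^\alpha B_{X^*}=\emptyset$ ($\omega_1$ if none), where $B_{X^*}$ is the closed unit ball of $X^*$; $\mathrm{Sz}(X)=\sup_{\epsilon>0}\mathrm{Sz}(X,\epsilon)$. $\omega_0$ is the first infinite ordinal; $\mathrm{Sz}(X)\le\omega_0$ means that $\mathrm{Sz}(X,\epsilon)$ is a finite ordinal for every $\epsilon>0$. For $K$ weak$^*$-compact convex, $\hat\iota_\epsilon K$ is the weak$^*$-closed convex hull of $\iota_\epsilon K$; $\mathrm{Cz}(X,\epsilon)$ is the least $n\in\mathbb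 N$ with $\hat\iota_\epsilon^{\,n}B_{X^*}=\emptyset$, and $\mathrm{Cz}(X,\epsilon)=\infty$ if there is no such $n$ (in particular $\mathrm{Cz}(X,0)=\infty$ for infinite-dimensional $X$). *)

theory Defs
  imports
    "HOL-Analysis.Analysis"
    "HOL-Library.Lattice_Constructions"
    "HOL-Library.Extended_Nat"
begin

subsection \<open>Countable ordinals and the ordinal \<open>\<omega>\<^sub>1\<close>\<close>

text \<open>
  A countable ordinal is an order type of a well-order on some subset of \<^typ>\<open>nat\<close>; the
  subset may be empty or finite.
\<close>

quotient_type countable_ordinal = "nat rel" / partial: "\<lambda>r s. (r, s) \<in> ordIso"
proof (rule part_equivpI)
  show "\<exists>r::nat rel. (r, r) \<in> ordIso"
    using natLeq_Well_order ordIso_reflexive by blast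
  show "symp (\<lambda>r s :: nat rel. (r, s) \<in> ordIso)"
    by (auto intro: sympI ordIso_symmetric)
  show "transp (\<lambda>r s :: nat rel. (r, s) \<in> ordIso)"
    by (auto intro: transpI ordIso_transitive)
qed

lemma ordIso_self_iff: "(r, r) \<in> ordIso \<longleftrightarrow> Well_order r"
  by (auto simp: ordIso_def intro: id_iso)

lemma countable_ordinal_cases:
  obtains r where "a = abs_countable_ordinal r" "Well_order r"
  by (induction a rule: countable_ordinal.abs_induct) (auto simp: ordIso_self_iff)

instantiation countable_ordinal :: linorder
begin

lift_definition less_eq_countable_ordinal ::
  "countable_ordinal \<Rightarrow> countable_ordinal \<Rightarrow> bool" is "\<lambda>r s. (r, s) \<in> ordLeq"
  by (meson ordIso_ordLeq_trans ordLeq_ordIso_trans ordIso_symmetric)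

lift_definition less_countable_ordinal ::
  "countable_ordinal \<Rightarrow> countable_ordinal \<Rightarrow> bool" is "\<lambda>r s. (r, s) \<in> ordLess"
  by (meson ordIso_ordLess_trans ordLess_ordIso_trans ordIso_symmetric)

instance
proof
  fix x y z :: countable_ordinal
  show "x < y \<longleftrightarrow> x \<le> y \<and> \<not> y \<le> x"
    by transfer (metis not_ordLeq_iff_ordLess ordIso_self_iff ordLess_imp_ordLeq)
  show "x \<le> x"
    by transfer (simp add: ordIso_self_iff ordLeq_reflexive)
  show "x \<le> y \<Longrightarrow> y \<le> z \<Longrightarrow> x \<le> z"
    by transfer (rule ordLeq_transitive)
  show "x \<le> y \<Longrightarrow> y \<le> x \<Longrightarrow> x = y"
    by transfer (simp add: ordIso_iff_ordLeq)
  show "x \<le> y \<or> y \<le> x"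
    by transfer (simp add: ordIso_self_iff ordLeq_total)
qed

end

instance countable_ordinal :: wellorder
proof
  fix P :: "countable_ordinal \<Rightarrow> bool" and a
  assume step: "\<And>x. (\<And>y. y < x \<Longrightarrow> P y) \<Longrightarrow> P x"
  have "Well_order r \<longrightarrow> P (abs_countable_ordinal r)" for r
  proof (induction r rule: wf_induct_rule[OF wf_ordLess])
    case (1 r)
    show ?case
    proof (rule impI, rule step)
      fix y assume r: "Well_order r" and y: "y < abs_countable_ordinal r"
      obtain s where s: "y = abs_countable_ordinal s" "Well_order s"
        by (rule countable_ordinal_cases)
      have "(s, r) \<in> ordLess"
        using y unfolding s(1)
        by (subst (asm) less_countable_ordinal.abs_eq)
          (rule ordIso_self_iff[THEN iffD2], fact s r)+
      then show "P y" unfolding s(1) using s(2) by (rule 1[THEN mp])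
    qed
  qed
  moreover obtain r where "a = abs_countable_ordinal r" "Well_order r"
    by (rule countable_ordinal_cases)
  ultimately show "P a" by simp
qed

lift_definition omega0 :: countable_ordinal ("\<omega>\<^sub>0") is natLeq
  by (simp add: ordIso_self_iff natLeq_Well_order)

lift_definition finite_ordinal :: "nat \<Rightarrow> countable_ordinal" is "\<lambda>n. natLeq_on n"
  by (simp add: ordIso_self_iff natLeq_on_Well_order)

lemma less_finite_ordinal_iff: "\<alpha> < finite_ordinal n \<longleftrightarrow> (\<exists>m<n. \<alpha> = finite_ordinal m)"
proof transfer
  fix \<alpha> :: "nat rel" and n
  assume "(\<alpha>, \<alpha>) \<in> ordIso"
  then have wo: "Well_order \<alpha>" by (simp add: ordIso_self_iff)
  have 1: "Field (natLeq_on n) = {x. x < n}" by (rule Field_natLeq_on)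
  have 2: "Restr (natLeq_on n) (underS (natLeq_on n) m) = natLeq_on m" if "m < n" for m
    using that by (auto simp: underS_def)
  show "(\<alpha>, natLeq_on n) \<in> ordLess \<longleftrightarrow> (\<exists>m<n. (\<alpha>, natLeq_on m) \<in> ordIso)"
    using ordLess_iff_ordIso_Restr[OF natLeq_on_Well_order wo, of n] 1 2 by auto
qed

lemma less_omega0_iff: "\<alpha> < \<omega>\<^sub>0 \<longleftrightarrow> (\<exists>n. \<alpha> = finite_ordinal n)"
proof transfer
  fix \<alpha> :: "nat rel"
  assume "(\<alpha>, \<alpha>) \<in> ordIso"
  then have wo: "Well_order \<alpha>" by (simp add: ordIso_self_iff)
  show "(\<alpha>, natLeq) \<in> ordLess \<longleftrightarrow> (\<exists>n. (\<alpha>, natLeq_on n) \<in> ordIso)"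
    using ordLess_iff_ordIso_Restr[OF natLeq_Well_order wo] 
    by (simp add: Restr_natLeq2 Field_natLeq)
qed

lemma finite_ordinal_less_iff [simp]: "finite_ordinal m < finite_ordinal n \<longleftrightarrow> m < n"
proof -
  have *: "m < n \<Longrightarrow> finite_ordinal m < finite_ordinal n" for m n
    using less_finite_ordinal_iff by blast
  show ?thesis
    using *[of m n] *[of n m] by (cases m n rule: linorder_cases) auto
qed

text \<open>
  Ordinals up to and including \<open>\<omega>\<^sub>1\<close>: \<^typ>\<open>countable_ordinal top\<close>, whose greatest element
  \<^term>\<open>top.Top\<close> is \<open>\<omega>\<^sub>1\<close>.
\<close>

abbreviation omega1 :: "countable_ordinal top" ("\<omega>\<^sub>1") where
  "\<omega>\<^sub>1 \<equiv> top.Top"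

instance top :: (wellorder) wellorder
proof
  fix P :: "'a top \<Rightarrow> bool" and a
  assume step: "\<And>x. (\<And>y. y < x \<Longrightarrow> P y) \<Longrightarrow> P x"
  have val: "P (top.Value x)" for x
  proof (induction x rule: less_induct)
    case (less x)
    show ?case
      by (rule step) (use less in \<open>auto simp: less_top_def split: top.splits\<close>)
  qed
  show "P a"
  proof (cases a)
    case Top
    show ?thesis
      by (rule step) (use val Top in \<open>auto simp: less_top_def split: top.splits\<close>)
  qed (simp add: val)
qed


subsection \<open>Transfinite iteration\<close>

definition is_predecessor :: "'o::wellorder \<Rightarrow> 'o \<Rightarrow> bool" where
  "is_predecessor \<beta> \<alpha> \<longleftrightarrow> \<beta> < \<alpha> \<and> (\<forall>\<gamma><\<alpha>. \<gamma> \<le> \<beta>)"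

lemma the_predecessor: "is_predecessor \<beta> \<alpha> \<Longrightarrow> (THE \<beta>. is_predecessor \<beta> \<alpha>) = \<beta>"
  unfolding is_predecessor_def by (rule the_equality) (auto intro: antisym)

text \<open>The three branches are \<open>\<alpha> = 0\<close>, \<open>\<alpha> = \<beta> + 1\<close>, and \<open>\<alpha>\<close> a limit ordinal.\<close>

function transfinite_iterate ::
  "('s set \<Rightarrow> 's set) \<Rightarrow> 's set \<Rightarrow> 'o::wellorder \<Rightarrow> 's set" where
  "transfinite_iterate F K \<alpha> =
    (if \<forall>\<beta>. \<alpha> \<le> \<beta> then K
     else if \<exists>\<beta>. is_predecessor \<beta> \<alpha>
       then F (transfinite_iterate F K (THE \<beta>. is_predecessor \<beta> \<alpha>))
     else (\<Inter>\<beta>\<in>{..<\<alpha>}. transfinite_iterate F K \<beta>))"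
  by pat_completeness auto
termination
proof (relation "inv_image {(x, y). x < y} (\<lambda>(F, K, \<alpha>). \<alpha>)", goal_cases)
  case 1
  show ?case using wf by (rule wf_inv_image)
next
  case (2 F K \<alpha>)
  then obtain \<beta> where "is_predecessor \<beta> \<alpha>" by blast
  then show ?case by (simp only: the_predecessor) (simp add: is_predecessor_def)
qed simp

declare transfinite_iterate.simps [simp del]

lemma transfinite_iterate_finite:
  "transfinite_iterate F K (finite_ordinal n) = (F ^^ n) K"
proof (induction n)
  case 0
  have "finite_ordinal 0 \<le> \<beta>" for \<beta>
    using less_finite_ordinal_iff[of \<beta> 0] by (simp add: not_less[symmetric])
  then show ?case by (simp add: transfinite_iterate.simps)
next
  case (Suc n)
  have pred: "is_predecessor (finite_ordinal n) (finite_ordinal (Suc n))"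
    unfolding is_predecessor_def
  proof (intro conjI allI impI)
    fix \<gamma> assume "\<gamma> < finite_ordinal (Suc n)"
    then obtain m where "m < Suc n" "\<gamma> = finite_ordinal m"
      using less_finite_ordinal_iff by blast
    then show "\<gamma> \<le> finite_ordinal n"
      by (simp add: not_less[symmetric])
  qed simp
  have "\<not> finite_ordinal (Suc n) \<le> finite_ordinal n"
    by (simp add: not_le)
  then have nz: "(\<forall>\<beta>. finite_ordinal (Suc n) \<le> \<beta>) = False"
    by blast
  have ex: "(\<exists>\<beta>. is_predecessor \<beta> (finite_ordinal (Suc n))) = True"
    using pred by blast
  show ?case
    by (subst transfinite_iterate.simps)
      (simp only: nz ex the_predecessor[OF pred] Suc.IH if_True if_False funpow.simps comp_apply)
qed

lemma transfinite_iterate_omega0: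
  "transfinite_iterate F K \<omega>\<^sub>0 = (\<Inter>n. (F ^^ n) K)"
proof -
  have lt: "{..<\<omega>\<^sub>0} = range finite_ordinal"
    by (auto simp: less_omega0_iff)
  have np: "\<not> is_predecessor \<beta> \<omega>\<^sub>0" for \<beta>
  proof
    assume "is_predecessor \<beta> \<omega>\<^sub>0"
    then obtain n where "\<beta> = finite_ordinal n" "finite_ordinal (Suc n) \<le> \<beta>"
      unfolding is_predecessor_def less_omega0_iff by blast
    then show False by (simp add: not_less[symmetric])
  qed
  have nz: "(\<forall>\<beta>. \<omega>\<^sub>0 \<le> \<beta>) = False"
    using less_omega0_iff not_less by blast
  show ?thesis
    by (subst transfinite_iterate.simps) (simp only: nz np lt, simp add: transfinite_iterate_finite)
qed


subsection \<open>The Szlenk and convex Szlenk indices\<close>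

text \<open>
  The dual space of \<^typ>\<open>'a\<close> is \<^typ>\<open>'a \<Rightarrow>\<^sub>L real\<close>. On it, the strong operator topology is the
  topology of pointwise convergence on \<^typ>\<open>'a\<close>, i.e. the weak* topology.
\<close>

abbreviation weak_star_topology :: "('a::real_normed_vector \<Rightarrow>\<^sub>L real) topology" where
  "weak_star_topology \<equiv> strong_operator_topology"

text \<open>
  The library's \<^const>\<open>diameter\<close> is only meaningful for bounded sets; weak*-compact sets in the
  dual of a Banach space are bounded, and all sets below are contained in the dual unit ball.
\<close>

definition szlenk_derivation ::
  "real \<Rightarrow> ('a::banach \<Rightarrow>\<^sub>L real) set \<Rightarrow> ('a \<Rightarrow>\<^sub>L real) set" where
  "szlenk_derivation \<epsilon> K =
    K - \<Union>{V. openin weak_star_topology V \<and> diameter (V \<inter> K) \<le> \<epsilon>}"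

definition convex_szlenk_derivation ::
  "real \<Rightarrow> ('a::banach \<Rightarrow>\<^sub>L real) set \<Rightarrow> ('a \<Rightarrow>\<^sub>L real) set" where
  "convex_szlenk_derivation \<epsilon> K =
    (\<lambda>C. convex C \<and> closedin weak_star_topology C) hull (szlenk_derivation \<epsilon> K)"

abbreviation dual_unit_ball :: "('a::banach \<Rightarrow>\<^sub>L real) set" where
  "dual_unit_ball \<equiv> cball 0 1"

definition Sz_eps :: "'a::banach itself \<Rightarrow> real \<Rightarrow> countable_ordinal top" where
  "Sz_eps _ \<epsilon> =
    (let vanishes = (\<lambda>\<alpha>::countable_ordinal.
       transfinite_iterate (szlenk_derivation \<epsilon>) (dual_unit_ball :: ('a \<Rightarrow>\<^sub>L real) set) \<alpha> = {})
     in if \<exists>\<alpha>. vanishes \<alpha> then top.Value (LEAST \<alpha>. vanishes \<alpha>) else \<omega>\<^sub>1)"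

text \<open>
  The supremum over all \<open>\<epsilon> > 0\<close>, as a least upper bound; it exists since \<^term>\<open>\<omega>\<^sub>1\<close> is an upper
  bound and \<^typ>\<open>countable_ordinal top\<close> is well-ordered.
\<close>

definition Sz :: "'a::banach itself \<Rightarrow> countable_ordinal top" where
  "Sz X = (LEAST \<sigma>. \<forall>\<epsilon>>0. Sz_eps X \<epsilon> \<le> \<sigma>)"

definition Cz :: "'a::banach itself \<Rightarrow> real \<Rightarrow> enat" where
  "Cz _ \<epsilon> =
    (let vanishes = (\<lambda>n.
       (convex_szlenk_derivation \<epsilon> ^^ n) (dual_unit_ball :: ('a \<Rightarrow>\<^sub>L real) set) = {})
     in if \<exists>n. vanishes n then enat (LEAST n. vanishes n) else \<infinity>)"

definition infinite_dimensional :: "'a::real_vector itself \<Rightarrow> bool" where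
  "infinite_dimensional _ \<longleftrightarrow> \<not> (\<exists>B::'a set. finite B \<and> span B = UNIV)"


subsection \<open>The condition \<open>Sz(X) \<le> \<omega>\<^sub>0\<close>\<close>

lemma Sz_eps_le_Sz: "\<epsilon> > 0 \<Longrightarrow> Sz_eps X \<epsilon> \<le> Sz X"
proof -
  have "\<forall>\<epsilon>>0. Sz_eps X \<epsilon> \<le> \<omega>\<^sub>1" by simp
  then have "\<forall>\<epsilon>>0. Sz_eps X \<epsilon> \<le> Sz X"
    unfolding Sz_def by (rule LeastI)
  then show "\<epsilon> > 0 \<Longrightarrow> Sz_eps X \<epsilon> \<le> Sz X" by blast
qed

lemma compactin_dual_unit_ball:
  "compactin weak_star_topology (dual_unit_ball :: ('a::banach \<Rightarrow>\<^sub>L real) set)"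
proof -
  let ?P = "PiE UNIV (\<lambda>x::'a. cball (0::real) (norm x))"
  let ?L = "(\<Inter>x y. {f. f (x + y) = f x + f y}) \<inter>
            (\<Inter>c x. {f::'a \<Rightarrow> real. f (c *\<^sub>R x) = c * f x})"
  have ev: "continuous_on UNIV (\<lambda>f::'a \<Rightarrow> real. f x)" for x
    by (rule continuous_on_product_coordinates)
  have clA: "closed {f::'a \<Rightarrow> real. f (x + y) = f x + f y}" for x y
    by (intro closed_Collect_eq continuous_intros ev)
  have clB: "closed {f::'a \<Rightarrow> real. f (c *\<^sub>R x) = c * f x}" for c x
    by (intro closed_Collect_eq continuous_intros ev)
  have cl: "closed ?L"
    using clA clB by (intro closed_Int closed_INT ballI) auto
  have "compactin (product_topology (\<lambda>_::'a. euclidean) UNIV) ?P"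
    by (subst compactin_PiE) simp
  then have "compact ?P"
    by (simp add: euclidean_product_topology flip: compactin_euclidean_iff)
  then have comp: "compact (?P \<inter> ?L)"
    using cl by (rule compact_Int_closed)
  have img: "blinfun_apply ` dual_unit_ball = ?P \<inter> ?L"
  proof (intro equalityI subsetI)
    fix g assume "g \<in> blinfun_apply ` (dual_unit_ball :: ('a \<Rightarrow>\<^sub>L real) set)"
    then obtain f :: "'a \<Rightarrow>\<^sub>L real" where f: "norm f \<le> 1" "g = blinfun_apply f" by auto
    have "\<bar>f x\<bar> \<le> norm x" for x
      using norm_blinfun[of f x] mult_right_mono[OF f(1), of "norm x"] by simp
    then show "g \<in> ?P \<inter> ?L"
      by (auto simp: f blinfun.bilinear_simps)
  next
    fix g assume g: "g \<in> ?P \<inter> ?L"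
    have add: "g (x + y) = g x + g y" for x y using g by (auto simp: algebra_simps)
    have scale: "g (c *\<^sub>R x) = c *\<^sub>R g x" for c x using g by auto
    have bnd: "norm (g x) \<le> norm x * 1" for x using g by (auto simp: PiE_iff)
    have bl: "bounded_linear g"
      by (rule bounded_linear_intro[where K = 1]) (auto simp: add scale bnd[simplified])
    then have "norm (Blinfun g) \<le> 1"
      by (intro norm_blinfun_bound) (use bnd in \<open>auto simp: bounded_linear_Blinfun_apply\<close>)
    then show "g \<in> blinfun_apply ` dual_unit_ball"
      using bl by (intro image_eqI[of _ _ "Blinfun g"]) (auto simp: bounded_linear_Blinfun_apply)
  qed
  show ?thesis
    unfolding compactin_def
  proof (intro conjI allI impI)
    fix \<U> :: "('a \<Rightarrow>\<^sub>L real) set set"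
    assume U: "Ball \<U> (openin weak_star_topology) \<and> dual_unit_ball \<subseteq> \<Union>\<U>"
    have "\<forall>V\<in>\<U>. \<exists>W. open W \<and> V = blinfun_apply -` W"
      using U unfolding strong_operator_topology_def
      by (auto simp: openin_pullback_topology)
    then obtain W where W: "\<And>V. V \<in> \<U> \<Longrightarrow> open (W V) \<and> V = blinfun_apply -` W V"
      by metis
    have "blinfun_apply ` dual_unit_ball \<subseteq> \<Union>(W ` \<U>)"
    proof (rule image_subsetI)
      fix f :: "'a \<Rightarrow>\<^sub>L real" assume "f \<in> dual_unit_ball"
      then obtain V where "V \<in> \<U>" "f \<in> V" using U by blast
      then show "blinfun_apply f \<in> \<Union>(W ` \<U>)" using W[of V] by blast
    qed
    then obtain \<F> where F: "\<F> \<subseteq> \<U>" "finite \<F>" "blinfun_apply ` dual_unit_ball \<subseteq> \<Union>(W ` \<F>)"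
      using comp[folded img] W
      by (metis (no_types, opaque_lifting) compactE_image image_eqI)
    have "dual_unit_ball \<subseteq> \<Union>\<F>"
    proof
      fix f :: "'a \<Rightarrow>\<^sub>L real" assume "f \<in> dual_unit_ball"
      then obtain V where "V \<in> \<F>" "blinfun_apply f \<in> W V" using F(3) by blast
      then show "f \<in> \<Union>\<F>" using W[of V] F(1) by blast
    qed
    then show "\<exists>\<F>. finite \<F> \<and> \<F> \<subseteq> \<U> \<and> dual_unit_ball \<subseteq> \<Union>\<F>"
      using F by blast
  qed (simp add: strong_operator_topology_topspace)
qed

lemma closedin_szlenk_derivation:
  assumes "closedin weak_star_topology K"
  shows "closedin weak_star_topology (szlenk_derivation \<epsilon> K)"
  unfolding szlenk_derivation_def
  by (intro closedin_diff assms openin_Union) auto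

lemma Sz_le_omega0_iff:
  "Sz (X :: 'a::banach itself) \<le> top.Value \<omega>\<^sub>0 \<longleftrightarrow>
    (\<forall>\<epsilon>>0. \<exists>n. Sz_eps X \<epsilon> = top.Value (finite_ordinal n))"
proof (intro iffI allI impI)
  assume "\<forall>\<epsilon>>0. \<exists>n. Sz_eps X \<epsilon> = top.Value (finite_ordinal n)"
  then have "\<forall>\<epsilon>>0. Sz_eps X \<epsilon> \<le> top.Value \<omega>\<^sub>0"
    by (metis less_eq_top_Value_Value less_imp_le less_omega0_iff)
  then show "Sz X \<le> top.Value \<omega>\<^sub>0"
    unfolding Sz_def by (rule Least_le)
next
  fix \<epsilon> :: real
  assume "Sz X \<le> top.Value \<omega>\<^sub>0" and "\<epsilon> > 0"
  then have le: "Sz_eps X \<epsilon> \<le> top.Value \<omega>\<^sub>0"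
    using Sz_eps_le_Sz order_trans by blast
  define B where "B = (dual_unit_ball :: ('a \<Rightarrow>\<^sub>L real) set)"
  define G where "G n = (szlenk_derivation \<epsilon> ^^ n) B" for n
  define vanishes where
    "vanishes \<alpha> \<longleftrightarrow> transfinite_iterate (szlenk_derivation \<epsilon>) B \<alpha> = {}"
    for \<alpha> :: countable_ordinal
  have Sz: "Sz_eps X \<epsilon> = (if \<exists>\<alpha>. vanishes \<alpha> then top.Value (LEAST \<alpha>. vanishes \<alpha>) else \<omega>\<^sub>1)"
    unfolding Sz_eps_def vanishes_def B_def Let_def ..
  obtain \<alpha> where \<alpha>: "Sz_eps X \<epsilon> = top.Value \<alpha>" "\<alpha> \<le> \<omega>\<^sub>0"
    using le by (cases "Sz_eps X \<epsilon>") (auto simp: less_eq_top_def)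
  then have van: "vanishes \<alpha>" "\<And>\<beta>. vanishes \<beta> \<Longrightarrow> \<alpha> \<le> \<beta>"
    using Sz by (auto split: if_splits intro: LeastI Least_le)
  have "\<alpha> \<noteq> \<omega>\<^sub>0"
  proof
    assume "\<alpha> = \<omega>\<^sub>0"
    then have emp: "(\<Inter>n. G n) = {}"
      using van(1) by (simp add: vanishes_def transfinite_iterate_omega0 G_def)
    have ne: "G n \<noteq> {}" for n
    proof
      assume "G n = {}"
      then have "vanishes (finite_ordinal n)"
        by (simp add: vanishes_def transfinite_iterate_finite G_def)
      then have "\<omega>\<^sub>0 \<le> finite_ordinal n" using van(2) \<open>\<alpha> = \<omega>\<^sub>0\<close> by blast
      then show False using less_omega0_iff[of "finite_ordinal n"] not_less by blast
    qed
    have comp: "compactin weak_star_topology B"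
      unfolding B_def by (rule compactin_dual_unit_ball)
    have "Hausdorff_space (weak_star_topology :: ('a \<Rightarrow>\<^sub>L real) topology)"
      unfolding Hausdorff_space_def strong_operator_topology_topspace
    proof (intro allI impI, elim conjE)
      fix f g :: "'a \<Rightarrow>\<^sub>L real" assume "f \<noteq> g"
      then obtain x where "f x \<noteq> g x" using blinfun_eqI by blast
      then obtain S T where ST: "open S" "open T" "f x \<in> S" "g x \<in> T" "S \<inter> T = {}"
        using hausdorff by metis
      have op: "openin weak_star_topology {h::'a \<Rightarrow>\<^sub>L real. h x \<in> Q}" if "open Q" for Q
        using openin_continuous_map_preimage[OF strong_operator_topology_continuous_evaluation[of x], of Q]
          that by (simp add: strong_operator_topology_topspace)
      show "\<exists>S T. openin weak_star_topology S \<and> openin weak_star_topology T \<and>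
        f \<in> S \<and> g \<in> T \<and> disjnt S T"
        using op[OF ST(1)] op[OF ST(2)] ST
        by (intro exI[of _ "{h. blinfun_apply h x \<in> S}"] exI[of _ "{h. blinfun_apply h x \<in> T}"])
          (auto simp: disjnt_def)
    qed
    then have "closedin weak_star_topology B"
      using comp compactin_imp_closedin by blast
    then have clo: "closedin weak_star_topology (G n)" for n
      by (induction n) (auto simp: G_def closedin_szlenk_derivation)
    have dec: "decseq G"
      by (rule decseq_SucI) (auto simp: G_def szlenk_derivation_def)
    have "B \<inter> \<Inter>(range G) \<noteq> {}"
    proof (rule comp[unfolded compactin_fip, THEN conjunct2, rule_format], intro conjI ballI allI impI)
      show "closedin weak_star_topology C" if "C \<in> range G" for C
        using that clo by auto
      fix \<F> assume "finite \<F> \<and> \<F> \<subseteq> range G"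
      then obtain N where N: "finite N" "\<F> = G ` N"
        by (meson finite_subset_image)
      have "G (Max (insert 0 N)) \<subseteq> B \<inter> \<Inter>\<F>"
        using decseqD[OF dec, of 0 "Max (insert 0 N)"] decseqD[OF dec, of _ "Max (insert 0 N)"] N
        by (auto simp: G_def subset_iff)
      then show "B \<inter> \<Inter>\<F> \<noteq> {}" using ne by blast
    qed
    with emp show False by blast
  qed
  then show "\<exists>n. Sz_eps X \<epsilon> = top.Value (finite_ordinal n)"
    using \<alpha> less_omega0_iff[of \<alpha>] by auto
qed

end

theory Submission
  imports Defs
begin

text \<open>
  Suppose that the dual ball of \<open>X\<close> disappears after \<open>N\<close> derivations. The support functions of the
  derived sets, raised by multiples of \<open>1/N\<close>, have a maximum \<open>F\<close> which lies between the norm and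
  the norm plus one, and which increases by at most \<open>1/N\<close> under perturbations of a definite size
  taken from a weak neighbourhood of zero. On the dual of \<open>Y\<close> consider the convex weak*
  lower semicontinuous functions
  \<open>\<Phi>\<^sub>t(y) = sup {y (U x - U x') / t - F ((x - x') / t)}\<close>; they are bounded because \<open>U\<close> is Lipschitz at
  large distances. If \<open>y'\<close> is weak* close to \<open>y\<close> but at distance more than \<open>\<tau>/2\<close>, then the Gorelik
  principle yields a point near the midpoint of an almost optimal pair \<open>x, x'\<close> at which \<open>y' - y\<close> is
  large, and this gives \<open>\<Phi>\<^sub>t\<^sub>/\<^sub>2(y) + \<Phi>\<^sub>t\<^sub>/\<^sub>2(y') \<ge> 2 \<Phi>\<^sub>t(y) + \<gamma>\<close> with \<open>\<gamma>\<close> of order \<open>1/N\<close>. Averaging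
  over dyadic scales \<open>t\<close> produces a bounded function which every derivation at scale \<open>\<tau>\<close> forces down by
  a fixed amount of order \<open>1/N\<close>, so that the dual ball of \<open>Y\<close> disappears after \<open>O(N)\<close> derivations;
  the multiplicative constant is then traded for a larger \<open>\<tau>\<close>.
\<close>

subsection \<open>The Hahn-Banach theorem\<close>

definition sublinear :: "('a::real_vector \<Rightarrow> real) \<Rightarrow> bool" where
  "sublinear p \<longleftrightarrow> (\<forall>x y. p (x + y) \<le> p x + p y) \<and> (\<forall>c>0. \<forall>x. p (c *\<^sub>R x) = c * p x)"

lemma sublinear_add: "sublinear p \<Longrightarrow> p (x + y) \<le> p x + p y"
  by (simp add: sublinear_def)

lemma sublinear_scale: "sublinear p \<Longrightarrow> 0 \<le> c \<Longrightarrow> p (c *\<^sub>R x) = c * p x"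
proof -
  assume p: "sublinear p" and c: "0 \<le> c"
  have "p (2 *\<^sub>R 0) = 2 * p 0" using p unfolding sublinear_def by (metis zero_less_numeral)
  then show ?thesis using p c by (cases "c = 0") (auto simp: sublinear_def)
qed

lemma sublinear_minus: "sublinear p \<Longrightarrow> - p (- x) \<le> p x"
  using sublinear_add[of p x "- x"] sublinear_scale[of p 0 0] by simp

text \<open>For sublinear \<open>p\<close> this is a sublinear minorant whose value at
  \<open>- z\<close> is at most \<open>- p z\<close>; a linear functional below it must agree with
  \<open>p\<close> at \<open>z\<close>.\<close>

definition tilt :: "('a::real_vector \<Rightarrow> real) \<Rightarrow> 'a \<Rightarrow> 'a \<Rightarrow> real" where
  "tilt p z y = (INF t\<in>{0..}. p (y + t *\<^sub>R z) - t * p z)"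

lemma tilt_bdd_below:
  assumes "sublinear p"
  shows "bdd_below ((\<lambda>t. p (y + t *\<^sub>R z) - t * p z) ` {0..})"
proof (rule bdd_belowI2[where m = "- p (- y)"])
  fix t :: real assume "t \<in> {0..}"
  then show "- p (- y) \<le> p (y + t *\<^sub>R z) - t * p z"
    using sublinear_add[OF assms, of "y + t *\<^sub>R z" "- y"] sublinear_scale[OF assms, of t z] by simp
qed

lemma tilt_le:
  assumes "sublinear p" "0 \<le> t"
  shows "tilt p z y \<le> p (y + t *\<^sub>R z) - t * p z"
  unfolding tilt_def using assms by (intro cINF_lower tilt_bdd_below) auto

lemma tilt_greatest:
  assumes "\<And>t. 0 \<le> t \<Longrightarrow> m \<le> p (y + t *\<^sub>R z) - t * p z"
  shows "m \<le> tilt p z y"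
  unfolding tilt_def using assms by (intro cINF_greatest) auto

lemma sublinear_tilt:
  assumes p: "sublinear p"
  shows "sublinear (tilt p z)"
proof -
  have add: "tilt p z (x + y) \<le> tilt p z x + tilt p z y" for x y
  proof -
    have *: "tilt p z (x + y) \<le> (p (x + s *\<^sub>R z) - s * p z) + (p (y + t *\<^sub>R z) - t * p z)"
      if "0 \<le> s" "0 \<le> t" for s t
      using tilt_le[OF p, of "s + t" z "x + y"] that
        sublinear_add[OF p, of "x + s *\<^sub>R z" "y + t *\<^sub>R z"] by (simp add: algebra_simps)
    have "tilt p z (x + y) - tilt p z y \<le> tilt p z x"
    proof (rule tilt_greatest)
      fix s :: real assume s: "0 \<le> s"
      have "tilt p z (x + y) - (p (x + s *\<^sub>R z) - s * p z) \<le> tilt p z y"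
        by (rule tilt_greatest) (use *[OF s] in \<open>simp add: algebra_simps\<close>)
      then show "tilt p z (x + y) - tilt p z y \<le> p (x + s *\<^sub>R z) - s * p z" by simp
    qed
    then show ?thesis by simp
  qed
  have scale_le: "tilt p z (c *\<^sub>R x) \<le> c * tilt p z x" if "c > 0" for c x
  proof -
    have "tilt p z (c *\<^sub>R x) / c \<le> tilt p z x"
    proof (rule tilt_greatest)
      fix t :: real assume "0 \<le> t"
      then have "tilt p z (c *\<^sub>R x) \<le> p (c *\<^sub>R (x + t *\<^sub>R z)) - c * t * p z"
        using tilt_le[OF p, of "c * t" z "c *\<^sub>R x"] that by (simp add: scaleR_add_right)
      also have "\<dots> = c * (p (x + t *\<^sub>R z) - t * p z)"
        using that by (simp only: sublinear_scale[OF p] less_imp_le) (simp add: algebra_simps)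
      finally show "tilt p z (c *\<^sub>R x) / c \<le> p (x + t *\<^sub>R z) - t * p z"
        using that by (simp add: field_simps)
    qed
    then show ?thesis using that by (simp add: field_simps)
  qed
  \<comment> \<open>The reverse inequality is \<open>scale_le\<close> for the factor
    \<open>inverse c\<close> at the point \<open>c x\<close>.\<close>
  have "tilt p z (c *\<^sub>R x) = c * tilt p z x" if "c > 0" for c x
    using scale_le[OF that, of x] scale_le[of "inverse c" "c *\<^sub>R x"] that
    by (simp add: field_simps)
  with add show ?thesis by (simp add: sublinear_def)
qed

text \<open>A minimal sublinear functional coincides with all its tilts, hence is additive.\<close>

lemma linear_minorant:
  assumes q: "sublinear q"
  obtains f where "linear f" "\<And>x. f x \<le> q x"
proof -
  define A where "A = {p. sublinear p \<and> p \<le> q}"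
  \<comment> \<open>The order is reversed, so Zorn's lemma yields a minimal functional.\<close>
  have po: "partial_order_on A (relation_of (\<lambda>a b. b \<le> a) A)"
    by (auto simp: partial_order_on_def preorder_on_def refl_on_def trans_def antisym_def relation_of_def)
  have "\<exists>u\<in>A. \<forall>a\<in>C. u \<le> a" if C: "C \<in> Chains (relation_of (\<lambda>a b. b \<le> a) A)" for C
  proof (cases "C = {}")
    case True
    then show ?thesis using q by (auto simp: A_def)
  next
    case False
    have CA: "p \<in> A" if "p \<in> C" for p
      using C that by (auto simp: Chains_def relation_of_def)
    have chain: "p \<le> p' \<or> p' \<le> p" if "p \<in> C" "p' \<in> C" for p p'
      using C that by (auto simp: Chains_def relation_of_def)
    define u where "u x = (INF p\<in>C. p x)" for x
    have bdd: "bdd_below ((\<lambda>p. p x) ` C)" for x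
    proof (rule bdd_belowI2[where m = "- q (- x)"])
      fix p assume "p \<in> C"
      then have "sublinear p" "p (- x) \<le> q (- x)" using CA by (auto simp: A_def le_fun_def)
      then show "- q (- x) \<le> p x" using sublinear_minus[of p x] by linarith
    qed
    have u_le: "u x \<le> p x" if "p \<in> C" for p x
      unfolding u_def using that by (intro cINF_lower bdd)
    have u_ge: "m \<le> u x" if "\<And>p. p \<in> C \<Longrightarrow> m \<le> p x" for m x
      unfolding u_def using that False by (intro cINF_greatest) auto
    have "u (x + y) \<le> u x + u y" for x y
    proof -
      \<comment> \<open>Replacing \<open>p\<close> and \<open>p'\<close> by the smaller of the two
        lets the infima over both summands be taken separately.\<close>
      have *: "u (x + y) \<le> p x + p' y" if pC: "p \<in> C" "p' \<in> C" for p p'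
      proof -
        obtain r where r: "r \<in> C" "r \<le> p" "r \<le> p'" using chain[OF pC] pC by auto
        have "u (x + y) \<le> r x + r y"
          using u_le[OF r(1), of "x + y"] CA[OF r(1)] sublinear_add[of r x y] by (auto simp: A_def)
        also have "\<dots> \<le> p x + p' y" using r by (intro add_mono) (auto simp: le_fun_def)
        finally show ?thesis .
      qed
      have "u (x + y) - u y \<le> u x"
      proof (rule u_ge)
        fix p assume "p \<in> C"
        have "u (x + y) - p x \<le> u y"
          by (rule u_ge) (use *[OF \<open>p \<in> C\<close>] in \<open>simp add: algebra_simps\<close>)
        then show "u (x + y) - u y \<le> p x" by simp
      qed
      then show ?thesis by simp
    qed
    moreover have "u (c *\<^sub>R x) = c * u x" if "c > 0" for c x
    proof -
      have *: "u (c *\<^sub>R x) / c \<le> u x" if "c > 0" for c x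
      proof (rule u_ge)
        fix p assume p: "p \<in> C"
        then have "p (c *\<^sub>R x) = c * p x" using CA that by (auto simp: A_def sublinear_scale)
        then show "u (c *\<^sub>R x) / c \<le> p x" using u_le[OF p, of "c *\<^sub>R x"] that by (simp add: field_simps)
      qed
      show ?thesis
        using *[OF that, of x] *[of "inverse c" "c *\<^sub>R x"] that by (simp add: field_simps)
    qed
    ultimately have "sublinear u" by (simp add: sublinear_def)
    moreover have "u \<le> q"
    proof -
      obtain p where "p \<in> C" using False by auto
      then have "p \<le> q" "u \<le> p" using CA u_le by (auto simp: A_def le_fun_def)
      then show ?thesis by simp
    qed
    ultimately show ?thesis using u_le by (auto simp: A_def le_fun_def)
  qed
  from predicate_Zorn[OF po this] obtain m
    where m: "sublinear m" "m \<le> q" "\<And>a. sublinear a \<Longrightarrow> a \<le> q \<Longrightarrow> a \<le> m \<Longrightarrow> a = m"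
    by (auto simp: A_def)
  have tilt: "tilt m z = m" for z
  proof (rule m(3))
    show "tilt m z \<le> m"
      using tilt_le[OF m(1), of 0 z] by (simp add: le_fun_def)
    then show "tilt m z \<le> q" using m(2) by simp
  qed (rule sublinear_tilt[OF m(1)])
  \<comment> \<open>The tilt at \<open>t = 1\<close> gives \<open>m x\<close> \<le>
    \<open>m (x + y) - m y\<close>, the superadditive half.\<close>
  have add: "m (x + y) = m x + m y" for x y
    using tilt_le[OF m(1), of 1 y x] sublinear_add[OF m(1), of x y] by (simp add: tilt)
  have neg: "m (- x) = - m x" for x
    using add[of x "- x"] sublinear_scale[OF m(1), of 0 0] by simp
  have "m (c *\<^sub>R x) = c * m x" for c x
    using sublinear_scale[OF m(1), of "\<bar>c\<bar>" x] neg[of "c *\<^sub>R x"] by (cases "c \<ge> 0") auto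
  then have "linear m" using add by (intro linearI) auto
  then show ?thesis using m(2) that by (auto simp: le_fun_def)
qed

text \<open>A linear minorant of \<open>tilt norm x\<close> is dominated by the norm, and at
  \<open>- x\<close> it is at most \<open>- norm x\<close>, which forces the full norm at
  \<open>x\<close>.\<close>

lemma norming_functional:
  fixes x :: "'a::real_normed_vector"
  obtains f :: "'a \<Rightarrow>\<^sub>L real" where "norm f \<le> 1" "blinfun_apply f x = norm x"
proof -
  have norm: "sublinear (norm :: 'a \<Rightarrow> real)"
    by (auto simp: sublinear_def norm_triangle_ineq)
  obtain f where f: "linear f" "\<And>y. f y \<le> tilt norm x y"
    using linear_minorant[OF sublinear_tilt[OF norm]] by blast
  have le: "f y \<le> norm y" for y
    using f(2)[of y] tilt_le[OF norm, of 0 x y] by simp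
  have abs: "norm (f y) \<le> 1 * norm y" for y
    using le[of y] le[of "- y"] linear_neg[OF f(1), of y] by simp
  then have bl: "bounded_linear f"
    using f(1) by (auto simp: bounded_linear_def bounded_linear_axioms_def intro!: exI[of _ 1])
  have "norm x \<le> f x"
    using f(2)[of "- x"] tilt_le[OF norm, of 1 x "- x"] linear_neg[OF f(1), of x] by simp
  with le[of x] have "f x = norm x" by simp
  moreover have "norm (Blinfun f) \<le> 1"
    using abs by (intro norm_blinfun_bound) (auto simp: bounded_linear_Blinfun_apply[OF bl])
  ultimately show ?thesis
    using that[of "Blinfun f"] by (simp add: bounded_linear_Blinfun_apply[OF bl])
qed

text \<open>Induction on \<open>S\<close>: a functional that vanishes on \<open>S\<close> is
  corrected at the new vector \<open>s\<close> by a multiple of one that vanishes on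
  \<open>S\<close> but not at \<open>s\<close>.\<close>

lemma separating_functional:
  fixes S :: "'a::real_normed_vector set"
  assumes "finite S" "x \<notin> span S"
  obtains f :: "'a \<Rightarrow>\<^sub>L real" where "\<And>s. s \<in> S \<Longrightarrow> blinfun_apply f s = 0" "blinfun_apply f x \<noteq> 0"
  using assms
proof (induction S arbitrary: x thesis rule: finite_induct)
  case empty
  then have "x \<noteq> 0" by simp
  then show ?case using norming_functional[of x] empty(1) by (metis empty_iff norm_eq_zero)
next
  case (insert s S)
  show ?case
  proof (cases "s \<in> span S")
    case True
    then have "x \<notin> span S" using insert.prems(2) by (simp add: span_redundant)
    then obtain f :: "'a \<Rightarrow>\<^sub>L real" where f: "\<And>s. s \<in> S \<Longrightarrow> blinfun_apply f s = 0" "blinfun_apply f x \<noteq> 0"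
      using insert.IH by blast
    have "blinfun_apply f s = 0"
      using True
    proof (induction rule: span_induct)
      case base
      then show ?case
        by (auto simp: subspace_def blinfun.bilinear_simps)
    qed (use f in auto)
    then show ?thesis using f insert.prems(1)[of f] by auto
  next
    case False
    then obtain f :: "'a \<Rightarrow>\<^sub>L real" where f: "\<And>s. s \<in> S \<Longrightarrow> blinfun_apply f s = 0" "blinfun_apply f s \<noteq> 0"
      using insert.IH by blast
    \<comment> \<open>The projection of \<open>x\<close> along \<open>s\<close> onto the kernel of
      \<open>f\<close>. It is the point where \<open>g\<close> must not vanish, because the
      corrected functional satisfies \<open>h x = g x'\<close>.\<close>
    define x' where "x' = x - (f x / f s) *\<^sub>R s"
    have "x' \<notin> span S"
    proof
      assume "x' \<in> span S"
      then have "x' \<in> span (insert s S)" using span_mono[OF subset_insertI] by blast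
      then have "x' + (f x / f s) *\<^sub>R s \<in> span (insert s S)"
        using span_scale[OF span_base[of s "insert s S"]] by (intro span_add) auto
      moreover have "x' + (f x / f s) *\<^sub>R s = x" by (simp add: x'_def)
      ultimately show False using insert.prems(2) by simp
    qed
    then obtain g :: "'a \<Rightarrow>\<^sub>L real" where g: "\<And>s. s \<in> S \<Longrightarrow> blinfun_apply g s = 0" "blinfun_apply g x' \<noteq> 0"
      using insert.IH by blast
    define h where "h = g - (g s / f s) *\<^sub>R f"
    have "h x = g x'"
      by (simp add: h_def x'_def blinfun.bilinear_simps)
    moreover have "h r = 0" if "r \<in> insert s S" for r
      using that f g by (auto simp: h_def blinfun.bilinear_simps)
    ultimately show ?thesis using g insert.prems(1)[of h] by auto
  qed
qed

subsection \<open>The weak* topology\<close>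

lemma openin_weak_star_nbhd:
  fixes g :: "'a::real_normed_vector \<Rightarrow>\<^sub>L real"
  assumes "finite I"
  shows "openin weak_star_topology {h. \<forall>x\<in>I. \<bar>blinfun_apply h x - blinfun_apply g x\<bar> < e}"
  using strong_operator_topology_basis[of I "\<lambda>x. ball (blinfun_apply g x) e" "\<lambda>x. x"] assms
  by (simp add: dist_real_def abs_minus_commute)

lemma closedin_weak_star_halfspace:
  "closedin weak_star_topology {h :: 'a::real_normed_vector \<Rightarrow>\<^sub>L real. blinfun_apply h x \<le> c}"
proof -
  have "openin weak_star_topology {h :: 'a \<Rightarrow>\<^sub>L real. \<forall>i\<in>{x}. blinfun_apply h i \<in> {c<..}}"
    by (rule strong_operator_topology_basis) auto
  moreover have "UNIV - {h :: 'a \<Rightarrow>\<^sub>L real. blinfun_apply h x \<le> c} =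
      {h. \<forall>i\<in>{x}. blinfun_apply h i \<in> {c<..}}"
    by auto
  ultimately show ?thesis
    by (simp add: closedin_def strong_operator_topology_topspace)
qed

lemma dual_unit_ball_abs_le:
  "f \<in> dual_unit_ball \<Longrightarrow> \<bar>blinfun_apply f x\<bar> \<le> norm x"
  using norm_blinfun[of f x] mult_right_mono[of "norm f" 1 "norm x"] by auto

lemma dual_unit_ball_alt:
  "(dual_unit_ball :: ('a::banach \<Rightarrow>\<^sub>L real) set) = (\<Inter>x. {h. blinfun_apply h x \<le> norm x})"
proof (intro equalityI subsetI)
  fix f :: "'a \<Rightarrow>\<^sub>L real" assume "f \<in> dual_unit_ball"
  then have "\<bar>blinfun_apply f x\<bar> \<le> norm x" for x by (rule dual_unit_ball_abs_le)
  then show "f \<in> (\<Inter>x. {h. blinfun_apply h x \<le> norm x})" by (auto intro: order_trans[OF abs_ge_self])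
next
  fix f :: "'a \<Rightarrow>\<^sub>L real" assume f: "f \<in> (\<Inter>x. {h. blinfun_apply h x \<le> norm x})"
  then have le: "f x \<le> norm x" for x by auto
  have "norm (f x) \<le> 1 * norm x" for x
    using le[of x] le[of "- x"] by (simp add: blinfun.bilinear_simps)
  then show "f \<in> dual_unit_ball" using norm_blinfun_bound[of 1 f] by simp
qed

lemma closedin_dual_unit_ball:
  "closedin weak_star_topology (dual_unit_ball :: ('a::banach \<Rightarrow>\<^sub>L real) set)"
  unfolding dual_unit_ball_alt by (intro closedin_Inter) (auto intro: closedin_weak_star_halfspace)

lemma continuous_map_weak_star_affine:
  "continuous_map weak_star_topology weak_star_topology
    (\<lambda>h :: 'a::real_normed_vector \<Rightarrow>\<^sub>L real. p + c *\<^sub>R (h - x))"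
proof (subst continuous_on_strong_operator_topo_iff_coordinatewise, intro allI)
  fix y :: 'a
  have "continuous_map euclidean euclidean (\<lambda>r. blinfun_apply p y + c * (r - blinfun_apply x y))"
    by (simp add: continuous_intros)
  from continuous_map_compose[OF strong_operator_topology_continuous_evaluation[of y] this]
  show "continuous_map weak_star_topology euclidean (\<lambda>h. blinfun_apply (p + c *\<^sub>R (h - x)) y)"
    by (simp add: o_def blinfun.bilinear_simps)
qed

subsection \<open>Szlenk derivations\<close>

lemma szlenk_derivation_subset: "szlenk_derivation \<epsilon> K \<subseteq> K"
  by (auto simp: szlenk_derivation_def)

text \<open>If all points near \<open>f\<close> were within \<epsilon>/2 of it, the triangle
  inequality would bound the diameter by \<epsilon>. This halving causes the factor 2 in
  \<open>2 * real k * \<epsilon>\<close> below.\<close>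

lemma szlenk_derivation_far_point:
  assumes "f \<in> szlenk_derivation \<epsilon> K" "openin weak_star_topology V" "f \<in> V"
  obtains h where "h \<in> V" "h \<in> K" "dist h f > \<epsilon> / 2"
proof (rule ccontr)
  assume "\<not> thesis"
  with that have near: "dist h f \<le> \<epsilon> / 2" if "h \<in> V \<inter> K" for h
    using that by (meson IntE not_le)
  have "diameter (V \<inter> K) \<le> \<epsilon>"
  proof (rule diameter_le)
    have "f \<in> K" using assms(1) szlenk_derivation_subset by blast
    then show "V \<inter> K \<noteq> {} \<or> 0 \<le> \<epsilon>" using assms(3) by blast
    fix h h' assume "h \<in> V \<inter> K" "h' \<in> V \<inter> K"
    then have "dist h f \<le> \<epsilon> / 2" "dist h' f \<le> \<epsilon> / 2" using near by auto
    then show "norm (h - h') \<le> \<epsilon>" using dist_triangle2[of h h' f] by (simp add: dist_norm)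
  qed
  then show False using assms by (auto simp: szlenk_derivation_def)
qed

lemma szlenk_derivationI:
  assumes "bounded K" "f \<in> K"
    and "\<And>V. openin weak_star_topology V \<Longrightarrow> f \<in> V \<Longrightarrow> \<exists>h\<in>V \<inter> K. dist h f > \<epsilon>"
  shows "f \<in> szlenk_derivation \<epsilon> K"
proof -
  have "\<not> diameter (V \<inter> K) \<le> \<epsilon>" if V: "openin weak_star_topology V" "f \<in> V" for V
  proof -
    obtain h where h: "h \<in> V \<inter> K" "dist h f > \<epsilon>" using assms(3)[OF V] by blast
    have "bounded (V \<inter> K)" using assms(1) by (rule bounded_subset) auto
    then have "dist h f \<le> diameter (V \<inter> K)"
      by (rule diameter_bounded_bound) (use h V assms(2) in auto)
    then show ?thesis using h by simp
  qed
  then show ?thesis using assms(2) by (auto simp: szlenk_derivation_def)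
qed

lemma not_in_szlenk_derivation:
  assumes "f \<in> K" "f \<notin> szlenk_derivation \<epsilon> K"
  obtains V where "openin weak_star_topology V" "f \<in> V" "diameter (V \<inter> K) \<le> \<epsilon>"
  using assms by (auto simp: szlenk_derivation_def)

lemma szlenk_derivation_mono:
  assumes "A \<subseteq> B" "bounded B" "\<epsilon>' \<le> \<epsilon>"
  shows "szlenk_derivation \<epsilon> A \<subseteq> szlenk_derivation \<epsilon>' B"
proof -
  have "diameter (V \<inter> A) \<le> \<epsilon>" if "diameter (V \<inter> B) \<le> \<epsilon>'" for V
    using diameter_subset[of "V \<inter> A" "V \<inter> B"] assms that
    by (meson Int_mono bounded_Int order.refl order_trans)
  then show ?thesis using assms(1) unfolding szlenk_derivation_def by blast
qed

lemma convex_closedin_convex_szlenk_derivation: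
  "convex (convex_szlenk_derivation \<epsilon> K)"
  "closedin weak_star_topology (convex_szlenk_derivation \<epsilon> K)"
proof -
  have "convex (\<Inter>T) \<and> closedin weak_star_topology (\<Inter>T)"
    if "\<forall>C\<in>T. convex C \<and> closedin weak_star_topology C" for T :: "('a \<Rightarrow>\<^sub>L real) set set"
  proof (cases "T = {}")
    case True
    then show ?thesis
      using closedin_topspace[of "weak_star_topology :: ('a \<Rightarrow>\<^sub>L real) topology"]
      by (simp add: strong_operator_topology_topspace)
  next
    case False
    then show ?thesis using that by (auto intro: convex_Inter)
  qed
  from hull_in[where S = "\<lambda>C. convex C \<and> closedin weak_star_topology C", OF this]
  show "convex (convex_szlenk_derivation \<epsilon> K)"
    "closedin weak_star_topology (convex_szlenk_derivation \<epsilon> K)"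
    unfolding convex_szlenk_derivation_def by auto
qed

lemma convex_szlenk_derivation_minimal:
  assumes "szlenk_derivation \<epsilon> K \<subseteq> C" "convex C" "closedin weak_star_topology C"
  shows "convex_szlenk_derivation \<epsilon> K \<subseteq> C"
  unfolding convex_szlenk_derivation_def using assms by (intro hull_minimal) auto

lemma szlenk_subset_convex_szlenk: "szlenk_derivation \<epsilon> K \<subseteq> convex_szlenk_derivation \<epsilon> K"
  unfolding convex_szlenk_derivation_def by (rule hull_subset)

lemma convex_szlenk_derivation_mono:
  assumes "A \<subseteq> B" "bounded B" "\<epsilon>' \<le> \<epsilon>"
  shows "convex_szlenk_derivation \<epsilon> A \<subseteq> convex_szlenk_derivation \<epsilon>' B"
  unfolding convex_szlenk_derivation_def by (intro hull_mono szlenk_derivation_mono assms)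

section \<open>Iterated convex derivations and the change of scale\<close>

context
  fixes K :: "('a::banach \<Rightarrow>\<^sub>L real) set"
  assumes K: "convex K" "closedin weak_star_topology K" "bounded K"
begin

lemma convex_szlenk_iterate_props:
  "convex ((convex_szlenk_derivation \<epsilon> ^^ n) K)"
  "closedin weak_star_topology ((convex_szlenk_derivation \<epsilon> ^^ n) K)"
  "(convex_szlenk_derivation \<epsilon> ^^ n) K \<subseteq> K"
  "bounded ((convex_szlenk_derivation \<epsilon> ^^ n) K)"
proof -
  have "convex ((convex_szlenk_derivation \<epsilon> ^^ n) K) \<and>
    closedin weak_star_topology ((convex_szlenk_derivation \<epsilon> ^^ n) K) \<and>
    (convex_szlenk_derivation \<epsilon> ^^ n) K \<subseteq> K"
  proof (induction n)
    case (Suc n)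
    have "convex_szlenk_derivation \<epsilon> ((convex_szlenk_derivation \<epsilon> ^^ n) K)
        \<subseteq> (convex_szlenk_derivation \<epsilon> ^^ n) K"
      using Suc.IH by (intro convex_szlenk_derivation_minimal szlenk_derivation_subset) auto
    then show ?case
      using Suc.IH convex_closedin_convex_szlenk_derivation by auto
  qed (use K in auto)
  then show "convex ((convex_szlenk_derivation \<epsilon> ^^ n) K)"
    "closedin weak_star_topology ((convex_szlenk_derivation \<epsilon> ^^ n) K)"
    "(convex_szlenk_derivation \<epsilon> ^^ n) K \<subseteq> K"
    "bounded ((convex_szlenk_derivation \<epsilon> ^^ n) K)"
    using K(3) bounded_subset by auto
qed

lemma szlenk_iterate_subset: "(szlenk_derivation \<epsilon> ^^ n) K \<subseteq> (convex_szlenk_derivation \<epsilon> ^^ n) K"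
proof (induction n)
  case (Suc n)
  show ?case
    using szlenk_derivation_mono[OF Suc convex_szlenk_iterate_props(4) order.refl]
      szlenk_subset_convex_szlenk by fastforce
qed simp

text \<open>Averaging \<open>k\<close> copies of a net which oscillates by \<open>k\<epsilon>\<close> trades one derivation for \<open>k\<close>
  derivations at scale \<open>\<epsilon>\<close>.\<close>

lemma szlenk_derivation_average:
  assumes x: "x \<in> szlenk_derivation (2 * real k * \<epsilon>) K" and "j \<le> k" "0 < k" "u \<in> K"
  shows "(real j / real k) *\<^sub>R x + (real (k - j) / real k) *\<^sub>R u \<in> (convex_szlenk_derivation \<epsilon> ^^ j) K"
  using assms(2-)
proof (induction j arbitrary: u)
  case (Suc j)
  define L where "L = (convex_szlenk_derivation \<epsilon> ^^ j) K"
  define p where "p = (real (Suc j) / real k) *\<^sub>R x + (real (k - Suc j) / real k) *\<^sub>R u"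
  have xK: "x \<in> K" using x szlenk_derivation_subset by blast
  \<comment> \<open>Exchanging one of the \<open>Suc j\<close> copies of \<open>x\<close> in
    \<open>p\<close> for \<open>y\<close> leaves \<open>j\<close> copies, so the result lies in the
    previous level \<open>L\<close>; \<open>q\<close> averages \<open>y\<close> with the copies of
    \<open>u\<close>.\<close>
  have in_L: "p + (1 / real k) *\<^sub>R (y - x) \<in> L" if "y \<in> K" for y
  proof -
    define r where "r = real k - real j"
    have r: "r \<ge> 1" "real (k - j) = r" "real (k - Suc j) = r - 1" "real j = real k - r"
      using Suc.prems by (auto simp: r_def of_nat_diff)
    define q where "q = (1 / r) *\<^sub>R y + ((r - 1) / r) *\<^sub>R u"
    have "q \<in> K"
      unfolding q_def using K(1) that Suc.prems(3)
      by (rule convexD) (use r in \<open>auto simp: field_simps\<close>)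
    then have "(real j / real k) *\<^sub>R x + (real (k - j) / real k) *\<^sub>R q \<in> L"
      unfolding L_def using Suc.prems by (intro Suc.IH) auto
    also have "(real j / real k) *\<^sub>R x + (real (k - j) / real k) *\<^sub>R q =
      p + (1 / real k) *\<^sub>R (y - x)"
    proof -
      have "(r / real k) *\<^sub>R q = (1 / real k) *\<^sub>R y + ((r - 1) / real k) *\<^sub>R u"
        using r(1) by (simp add: q_def scaleR_add_right)
      moreover have "real (Suc j) / real k = (real k - r) / real k + 1 / real k"
        using r(4) by (simp add: add_divide_distrib)
      ultimately show ?thesis
        unfolding p_def r(2,3,4) by (simp add: scaleR_add_left scaleR_diff_right)
    qed
    finally show ?thesis .
  qed
  have "p \<in> szlenk_derivation \<epsilon> L"
  proof (rule szlenk_derivationI)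
    show "bounded L" unfolding L_def by (rule convex_szlenk_iterate_props)
    show "p \<in> L" using in_L[OF xK] by simp
    fix V assume V: "openin weak_star_topology V" "p \<in> V"
    define V' where "V' = {h. p + (1 / real k) *\<^sub>R (h - x) \<in> V}"
    have "openin weak_star_topology V'"
      using openin_continuous_map_preimage[OF continuous_map_weak_star_affine V(1)]
      by (simp add: V'_def strong_operator_topology_topspace)
    moreover have "x \<in> V'" using V(2) by (simp add: V'_def)
    \<comment> \<open>A neighbour \<open>y\<close> of \<open>x\<close> at distance more than
      \<open>k \<epsilon>\<close> moves the average by one \<open>k\<close>-th of that, hence by
      more than \<epsilon>.\<close>
    ultimately obtain y where y: "y \<in> V'" "y \<in> K" "dist y x > (2 * real k * \<epsilon>) / 2"
      by (rule szlenk_derivation_far_point[OF x])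
    have "dist (p + (1 / real k) *\<^sub>R (y - x)) p > \<epsilon>"
      using y(3) Suc.prems(2) by (simp add: dist_norm pos_less_divide_eq mult.commute)
    then show "\<exists>h\<in>V \<inter> L. dist h p > \<epsilon>"
      using y in_L by (intro bexI[of _ "p + (1 / real k) *\<^sub>R (y - x)"]) (auto simp: V'_def)
  qed
  then show ?case
    using szlenk_subset_convex_szlenk unfolding L_def p_def by auto
qed simp

lemma szlenk_derivation_subset_iterate:
  assumes "0 < k"
  shows "szlenk_derivation (2 * real k * \<epsilon>) K \<subseteq> (convex_szlenk_derivation \<epsilon> ^^ k) K"
proof
  fix x assume x: "x \<in> szlenk_derivation (2 * real k * \<epsilon>) K"
  then have "x \<in> K" using szlenk_derivation_subset by blast
  from szlenk_derivation_average[OF x order.refl assms this] assms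
  show "x \<in> (convex_szlenk_derivation \<epsilon> ^^ k) K" by simp
qed

end

text \<open>This later absorbs a constant factor in the number of derivations into the scale. Each
  large derivation lies in a block of \<open>k\<close> small ones; taking the hull loses nothing
  because the iterates are convex and weak* closed.\<close>

lemma convex_szlenk_iterate_subset_iterate:
  assumes K: "convex K" "closedin weak_star_topology K" "bounded K" and "0 < k"
  shows "(convex_szlenk_derivation (2 * real k * \<epsilon>) ^^ n) K \<subseteq> (convex_szlenk_derivation \<epsilon> ^^ (k * n)) K"
proof (induction n)
  case (Suc n)
  let ?A = "(convex_szlenk_derivation \<epsilon> ^^ (k * n)) K"
  note A = convex_szlenk_iterate_props[OF K, where n = "k * n" and \<epsilon> = \<epsilon>]
  have "(convex_szlenk_derivation (2 * real k * \<epsilon>) ^^ Suc n) K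
      \<subseteq> convex_szlenk_derivation (2 * real k * \<epsilon>) ?A"
    using convex_szlenk_derivation_mono[OF Suc A(4) order.refl] by simp
  also have "\<dots> \<subseteq> (convex_szlenk_derivation \<epsilon> ^^ k) ?A"
    using convex_szlenk_iterate_props(1,2)[OF A(1,2,4)]
    by (intro convex_szlenk_derivation_minimal szlenk_derivation_subset_iterate[OF A(1,2,4)] assms)
  finally show ?case by (simp add: funpow_add)
qed simp

section \<open>The indices in terms of finite iterates\<close>

lemma dual_unit_ball_props:
  "convex (dual_unit_ball :: ('a::banach \<Rightarrow>\<^sub>L real) set)"
  "closedin weak_star_topology (dual_unit_ball :: ('a \<Rightarrow>\<^sub>L real) set)"
  "bounded (dual_unit_ball :: ('a \<Rightarrow>\<^sub>L real) set)"
  by (auto intro: closedin_dual_unit_ball)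

lemma Cz_le_iff:
  "Cz TYPE('a::banach) \<epsilon> \<le> enat n \<longleftrightarrow>
    (convex_szlenk_derivation \<epsilon> ^^ n) (dual_unit_ball :: ('a \<Rightarrow>\<^sub>L real) set) = {}"
proof -
  define v where "v n \<longleftrightarrow> (convex_szlenk_derivation \<epsilon> ^^ n) (dual_unit_ball :: ('a \<Rightarrow>\<^sub>L real) set) = {}" for n
  have Cz: "Cz TYPE('a) \<epsilon> = (if \<exists>n. v n then enat (LEAST n. v n) else \<infinity>)"
    by (simp add: Cz_def v_def)
  \<comment> \<open>The derivation of the empty set is empty, so vanishing persists.\<close>
  have "v (Suc m)" if "v m" for m
    using that convex_szlenk_derivation_minimal[OF szlenk_derivation_subset, of "{}"]
    by (simp add: v_def)
  then have mono: "v n" if "v m" "m \<le> n" for m n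
    using that by (induction n) (auto simp: le_Suc_eq)
  show ?thesis
    unfolding v_def[symmetric] Cz
  proof (cases "\<exists>n. v n")
    case True
    then have "v (LEAST n. v n)" by (rule LeastI_ex)
    then have "(LEAST n. v n) \<le> n \<longleftrightarrow> v n" using mono Least_le[of v n] by blast
    with True show "(if \<exists>n. v n then enat (LEAST n. v n) else \<infinity>) \<le> enat n \<longleftrightarrow> v n" by simp
  qed auto
qed

text \<open>At scale zero only weak* isolated points of the ball can be removed. In infinite
  dimension there are none: a nonzero point can be shrunk slightly, and every weak* neighbourhood of
  zero contains functionals of norm one.\<close>

lemma szlenk_derivation_zero_dual_unit_ball:
  assumes inf: "infinite_dimensional TYPE('a::banach)"
  shows "szlenk_derivation 0 (dual_unit_ball :: ('a \<Rightarrow>\<^sub>L real) set) = dual_unit_ball"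
proof (rule equalityI[OF szlenk_derivation_subset], rule subsetI, rule szlenk_derivationI)
  fix f :: "'a \<Rightarrow>\<^sub>L real" and V
  assume f: "f \<in> dual_unit_ball" and V: "openin weak_star_topology V" "f \<in> V"
  show "\<exists>h\<in>V \<inter> dual_unit_ball. dist h f > 0"
  proof (cases "f = 0")
    case False
    have cont: "continuous_map euclidean weak_star_topology (\<lambda>r::real. r *\<^sub>R f)"
      by (subst continuous_on_strong_operator_topo_iff_coordinatewise)
        (simp add: blinfun.scaleR_left continuous_intros)
    have "open {r::real. r *\<^sub>R f \<in> V}"
      using openin_continuous_map_preimage[OF cont V(1)] by simp
    moreover have "1 \<in> {r::real. r *\<^sub>R f \<in> V}" using V(2) by simp
    ultimately obtain e where e: "e > 0" "ball 1 e \<subseteq> {r::real. r *\<^sub>R f \<in> V}"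
      by (rule openE)
    define r where "r = 1 - min 1 e / 2"
    have r: "0 \<le> r" "r < 1" "dist r 1 < e" using e(1) by (auto simp: r_def dist_real_def)
    have "norm (r *\<^sub>R f) \<le> 1 * 1"
      unfolding norm_scaleR using r f by (intro mult_mono) auto
    moreover have "r *\<^sub>R f \<noteq> 1 *\<^sub>R f"
      unfolding scaleR_cancel_right using r(2) False by simp
    ultimately show ?thesis using e(2) r by (intro bexI[of _ "r *\<^sub>R f"]) (auto simp: dist_commute)
  next
    case True
    obtain W where W: "open W" "V = blinfun_apply -` W"
      using V(1) unfolding strong_operator_topology_def by (auto simp: openin_pullback_topology)
    then have "openin (product_topology (\<lambda>_::'a. euclidean) UNIV) W" "blinfun_apply f \<in> W"
      using V(2) by (simp_all add: open_fun_def)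
    from product_topology_open_contains_basis[OF this] obtain X
      where X: "blinfun_apply f \<in> (\<Pi>\<^sub>E i\<in>UNIV. X i)" "finite {i. X i \<noteq> UNIV}" "(\<Pi>\<^sub>E i\<in>UNIV. X i) \<subseteq> W"
      by auto
    \<comment> \<open>The neighbourhood constrains only the finitely many coordinates in
      \<open>I\<close>; a functional that vanishes on \<open>I\<close> agrees there with
      \<open>f = 0\<close>, whatever its norm.\<close>
    define I where "I = {i. X i \<noteq> UNIV}"
    obtain x where "x \<notin> span I"
      using inf X(2) unfolding infinite_dimensional_def I_def by blast
    then obtain g :: "'a \<Rightarrow>\<^sub>L real" where g: "\<And>s. s \<in> I \<Longrightarrow> blinfun_apply g s = 0" "blinfun_apply g x \<noteq> 0"
      using separating_functional[of I x] X(2) unfolding I_def by blast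
    then have "g \<noteq> 0" by auto
    define h where "h = (1 / norm g) *\<^sub>R g"
    have "blinfun_apply h i \<in> X i" for i
    proof (cases "i \<in> I")
      case True
      then show ?thesis using g(1)[of i] X(1) \<open>f = 0\<close> by (auto simp: h_def blinfun.scaleR_left PiE_iff)
    qed (simp add: I_def)
    then have "blinfun_apply h \<in> W" using X(3) by auto
    then show ?thesis using W(2) True \<open>g \<noteq> 0\<close> by (intro bexI[of _ h]) (auto simp: h_def)
  qed
qed auto

text \<open>The endpoint \<tau> = 0 of the theorem: a derivation at scale zero leaves the ball in
  place.\<close>

lemma Cz_zero:
  assumes inf: "infinite_dimensional TYPE('a::banach)"
  shows "Cz TYPE('a) 0 = \<infinity>"
proof -
  have "(dual_unit_ball :: ('a \<Rightarrow>\<^sub>L real) set) \<subseteq> (convex_szlenk_derivation 0 ^^ n) dual_unit_ball" for n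
  proof (induction n)
    case (Suc n)
    show ?case
      using szlenk_derivation_mono[OF Suc convex_szlenk_iterate_props(4)[OF dual_unit_ball_props] order.refl, of 0]
        szlenk_subset_convex_szlenk
      by (fastforce simp: szlenk_derivation_zero_dual_unit_ball[OF inf])
  qed simp
  then have "\<not> Cz TYPE('a) 0 \<le> enat n" for n
    unfolding Cz_le_iff by (metis cball_eq_empty not_one_less_zero subset_empty)
  then show ?thesis by (cases "Cz TYPE('a) 0") auto
qed

text \<open>Removes ordinals from the argument: iterates at finite ordinals are function powers, and
  a least vanishing ordinal bounded by a finite one is itself finite.\<close>

lemma Sz_le_omega0_iff_iterate:
  "Sz TYPE('a::banach) \<le> top.Value \<omega>\<^sub>0 \<longleftrightarrow>
    (\<forall>\<epsilon>>0. \<exists>n. (szlenk_derivation \<epsilon> ^^ n) (dual_unit_ball :: ('a \<Rightarrow>\<^sub>L real) set) = {})"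
proof -
  have "(\<exists>n. Sz_eps TYPE('a) \<epsilon> = top.Value (finite_ordinal n)) \<longleftrightarrow>
    (\<exists>n. (szlenk_derivation \<epsilon> ^^ n) (dual_unit_ball :: ('a \<Rightarrow>\<^sub>L real) set) = {})" for \<epsilon>
  proof -
    define v where "v \<alpha> \<longleftrightarrow> transfinite_iterate (szlenk_derivation \<epsilon>) (dual_unit_ball :: ('a \<Rightarrow>\<^sub>L real) set) \<alpha> = {}"
      for \<alpha> :: countable_ordinal
    have Sz: "Sz_eps TYPE('a) \<epsilon> = (if \<exists>\<alpha>. v \<alpha> then top.Value (LEAST \<alpha>. v \<alpha>) else \<omega>\<^sub>1)"
      by (simp add: Sz_eps_def v_def)
    have v: "v (finite_ordinal n) \<longleftrightarrow> (szlenk_derivation \<epsilon> ^^ n) (dual_unit_ball :: ('a \<Rightarrow>\<^sub>L real) set) = {}" for n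
      by (simp add: v_def transfinite_iterate_finite)
    have "(\<exists>n. Sz_eps TYPE('a) \<epsilon> = top.Value (finite_ordinal n)) \<longleftrightarrow> (\<exists>n. v (finite_ordinal n))"
    proof
      assume "\<exists>n. Sz_eps TYPE('a) \<epsilon> = top.Value (finite_ordinal n)"
      then obtain n where n: "Sz_eps TYPE('a) \<epsilon> = top.Value (finite_ordinal n)" by blast
      then have ex: "\<exists>\<alpha>. v \<alpha>" and "(LEAST \<alpha>. v \<alpha>) = finite_ordinal n"
        using Sz by (auto split: if_splits)
      then show "\<exists>n. v (finite_ordinal n)" using LeastI_ex[OF ex] by metis
    next
      assume "\<exists>n. v (finite_ordinal n)"
      then obtain n where n: "v (finite_ordinal n)" by blast
      then have "(LEAST \<alpha>. v \<alpha>) \<le> finite_ordinal n" by (rule Least_le)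
      then have "(LEAST \<alpha>. v \<alpha>) < \<omega>\<^sub>0" using less_omega0_iff[of "finite_ordinal n"] by auto
      then show "\<exists>n. Sz_eps TYPE('a) \<epsilon> = top.Value (finite_ordinal n)"
        using n Sz less_omega0_iff by auto
    qed
    then show ?thesis by (simp add: v)
  qed
  then show ?thesis by (simp add: Sz_le_omega0_iff)
qed

subsection \<open>Asymptotically flat functions\<close>

text \<open>A form of asymptotic uniform smoothness at the single size \<sigma>. The pair
  \<open>S\<close>, \<kappa> encodes a weak neighbourhood of zero in place of a subspace of finite
  codimension; it may depend on \<open>x\<close> and on the extra error \<delta>.\<close>

definition asymptotically_flat :: "('a::real_normed_vector \<Rightarrow> real) \<Rightarrow> real \<Rightarrow> real \<Rightarrow> bool" where
  "asymptotically_flat F \<sigma> \<eta> \<longleftrightarrow> (\<forall>x. \<forall>\<delta>>0. \<exists>(S :: ('a \<Rightarrow>\<^sub>L real) set) \<kappa>. finite S \<and> \<kappa> > 0 \<and>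
    (\<forall>w. norm w \<le> \<sigma> \<and> (\<forall>f\<in>S. \<bar>blinfun_apply f w\<bar> \<le> \<kappa>) \<longrightarrow> F (x + w) \<le> F x + \<eta> + \<delta>))"

text \<open>The function \<open>F\<close> is the maximum of the support functions of the \<open>K j\<close>, the \<open>j\<close>-th one raised
  by \<open>j * \<mu>\<close>. A large oscillation at \<open>f \<in> K j\<close> is paid for by \<open>f\<close> lying in a much later set.\<close>

lemma asymptotically_flat_function:
  fixes K :: "nat \<Rightarrow> ('a::banach \<Rightarrow>\<^sub>L real) set" and \<sigma> \<mu> \<eta> :: real
  assumes K0: "K 0 = dual_unit_ball"
    and KN: "\<And>j. N \<le> j \<Longrightarrow> K j = {}"
    and sub: "\<And>j. K j \<subseteq> dual_unit_ball"
    and clo: "\<And>j. closedin weak_star_topology (K j)"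
    and osc: "\<And>j f. f \<in> K j \<Longrightarrow> \<exists>k V. f \<in> K (j + k) \<and> openin weak_star_topology V \<and> f \<in> V \<and>
      \<sigma> * diameter (V \<inter> K j) \<le> real k * \<mu> + \<eta>"
    and \<mu>: "\<mu> \<ge> 0" "real N * \<mu> \<le> 1"
  obtains F :: "'a \<Rightarrow> real"
  where "\<And>x. norm x \<le> F x" "F 0 \<le> 1" "asymptotically_flat F \<sigma> \<eta>"
proof -
  define I where "I = Sigma {..<N} K"
  define F where "F x = (SUP p\<in>I. blinfun_apply (snd p) x + real (fst p) * \<mu>)" for x
  have "N > 0"
  proof (rule ccontr)
    assume "\<not> N > 0"
    then have "K 0 = {}" using KN by simp
    moreover have "0 \<in> K 0" by (simp add: K0)
    ultimately show False by blast
  qed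
  then have ne: "(0, 0) \<in> I" by (auto simp: I_def K0)
  have j\<mu>: "real j * \<mu> \<le> 1" if "j < N" for j
    using mult_right_mono[of "real j" "real N" \<mu>] that \<mu> by auto
  have val_le: "blinfun_apply (snd p) x + real (fst p) * \<mu> \<le> norm x + 1" if "p \<in> I" for p x
  proof -
    have "snd p \<in> dual_unit_ball" "fst p < N" using that sub[of "fst p"] by (auto simp: I_def)
    then show ?thesis using dual_unit_ball_abs_le[of "snd p" x] j\<mu>[of "fst p"] by linarith
  qed
  have upper: "blinfun_apply f x + real j * \<mu> \<le> F x" if "f \<in> K j" for f j x
  proof -
    have "j < N" using KN[of j] that by (cases "j < N") auto
    then have "(j, f) \<in> I" using that by (simp add: I_def)
    then show ?thesis
      unfolding F_def by (intro cSUP_upper2[of _ _ "(j, f)"] bdd_aboveI2[OF val_le]) auto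
  qed
  have least: "F x \<le> m" if "\<And>j f. j < N \<Longrightarrow> f \<in> K j \<Longrightarrow> blinfun_apply f x + real j * \<mu> \<le> m" for x m
    unfolding F_def using ne that by (intro cSUP_least) (auto simp: I_def)
  have "norm x \<le> F x" for x
  proof -
    obtain f :: "'a \<Rightarrow>\<^sub>L real" where f: "norm f \<le> 1" "blinfun_apply f x = norm x"
      by (rule norming_functional)
    then show ?thesis using upper[of f 0 x] by (simp add: K0)
  qed
  moreover have "F 0 \<le> 1"
    by (rule least) (simp add: j\<mu>)
  moreover have "asymptotically_flat F \<sigma> \<eta>"
    unfolding asymptotically_flat_def
  proof (intro allI impI)
    fix x :: 'a and \<delta> :: real assume \<delta>: "\<delta> > 0"
    have "\<exists>G. finite G \<and> (\<forall>f\<in>K j. \<forall>w. norm w \<le> \<sigma> \<and> (\<forall>g\<in>G. \<bar>blinfun_apply g w\<bar> \<le> \<delta> / 2) \<longrightarrow>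
        blinfun_apply f (x + w) + real j * \<mu> \<le> F x + \<eta> + \<delta>)" for j
    proof -
      obtain k V where kV: "\<And>g. g \<in> K j \<Longrightarrow> g \<in> K (j + k g)"
        "\<And>g. g \<in> K j \<Longrightarrow> openin weak_star_topology (V g)" "\<And>g. g \<in> K j \<Longrightarrow> g \<in> V g"
        "\<And>g. g \<in> K j \<Longrightarrow> \<sigma> * diameter (V g \<inter> K j) \<le> real (k g) * \<mu> + \<eta>"
        using osc[of _ j] by metis
      \<comment> \<open>The second factor keeps \<open>f x\<close> within \<delta>/2 of
        \<open>g x\<close>; the other half of \<delta> bounds the values of \<open>g\<close> at
        \<open>w\<close>.\<close>
      define W where "W g = V g \<inter> {h. \<forall>y\<in>{x}. \<bar>blinfun_apply h y - blinfun_apply g y\<bar> < \<delta> / 2}" for g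
      have W_open: "openin weak_star_topology (W g)" if "g \<in> K j" for g
        unfolding W_def using that by (intro openin_Int openin_weak_star_nbhd kV) auto
      \<comment> \<open>Compactness leaves finitely many centres \<open>g\<close>, and these become
        the functionals tested on \<open>w\<close>.\<close>
      have "compactin weak_star_topology (K j)"
        using closed_compactin[OF compactin_dual_unit_ball sub clo] .
      moreover have "K j \<subseteq> \<Union>(W ` K j)" using kV(3) \<delta> by (auto simp: W_def)
      ultimately obtain \<F> where "finite \<F>" "\<F> \<subseteq> W ` K j" "K j \<subseteq> \<Union>\<F>"
        unfolding compactin_def using W_open by (metis (no_types, lifting) imageE)
      then obtain G where G: "finite G" "G \<subseteq> K j" "K j \<subseteq> \<Union>(W ` G)"
        by (metis finite_subset_image)
      have "blinfun_apply f (x + w) + real j * \<mu> \<le> F x + \<eta> + \<delta>"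
        if f: "f \<in> K j" and w: "norm w \<le> \<sigma>" "\<forall>g\<in>G. \<bar>blinfun_apply g w\<bar> \<le> \<delta> / 2" for f w
      proof -
        obtain g where g: "g \<in> G" "f \<in> W g" using G f by blast
        then have gK: "g \<in> K j" using G by blast
        have "\<bar>blinfun_apply f x - blinfun_apply g x\<bar> < \<delta> / 2" using g(2) by (simp add: W_def)
        then have fV: "f \<in> V g" "blinfun_apply f x < blinfun_apply g x + \<delta> / 2"
          using g(2) by (simp add: W_def, linarith)
        have "bounded (V g \<inter> K j)"
          by (rule bounded_subset[OF bounded_cball[of 0 1]]) (use sub in blast)
        then have diam: "norm (f - g) \<le> diameter (V g \<inter> K j)"
          using diameter_bounded_bound[of "V g \<inter> K j" f g] f fV(1) gK kV(3)[OF gK] by (simp add: dist_norm)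
        have "blinfun_apply f w - blinfun_apply g w \<le> norm (f - g) * norm w"
          using norm_blinfun[of "f - g" w] by (simp add: blinfun.diff_left)
        also have "\<dots> \<le> diameter (V g \<inter> K j) * \<sigma>"
          using diam w(1) by (intro mult_mono) (auto intro: order_trans[OF norm_ge_zero])
        also have "\<dots> \<le> real (k g) * \<mu> + \<eta>" using kV(4)[OF gK] by (simp add: mult.commute)
        finally have "blinfun_apply f w \<le> \<delta> / 2 + real (k g) * \<mu> + \<eta>" using w(2) g(1) by fastforce
        \<comment> \<open>Since \<open>g\<close> survives to level \<open>j + k g\<close>, it enters
          \<open>F x\<close> with an extra \<open>k g\<close> times \<mu>, which pays for the
          oscillation up to \<eta>.\<close>
        moreover have "blinfun_apply g x + real (j + k g) * \<mu> \<le> F x" using kV(1)[OF gK] by (rule upper)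
        ultimately show ?thesis using fV(2) by (simp add: blinfun.add_right algebra_simps)
      qed
      then show ?thesis using G(1) by blast
    qed
    then obtain G where G: "\<And>j. finite (G j)"
      "\<And>j f w. f \<in> K j \<Longrightarrow> norm w \<le> \<sigma> \<Longrightarrow> \<forall>g\<in>G j. \<bar>blinfun_apply g w\<bar> \<le> \<delta> / 2 \<Longrightarrow>
        blinfun_apply f (x + w) + real j * \<mu> \<le> F x + \<eta> + \<delta>"
      by metis
    show "\<exists>(S :: ('a \<Rightarrow>\<^sub>L real) set) \<kappa>. finite S \<and> \<kappa> > 0 \<and>
      (\<forall>w. norm w \<le> \<sigma> \<and> (\<forall>f\<in>S. \<bar>blinfun_apply f w\<bar> \<le> \<kappa>) \<longrightarrow> F (x + w) \<le> F x + \<eta> + \<delta>)"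
    proof (intro exI conjI allI impI)
      show "finite (\<Union>j<N. G j)" using G(1) by auto
      show "\<delta> / 2 > 0" using \<delta> by simp
      fix w assume "norm w \<le> \<sigma> \<and> (\<forall>f\<in>\<Union>j<N. G j. \<bar>blinfun_apply f w\<bar> \<le> \<delta> / 2)"
      then show "F (x + w) \<le> F x + \<eta> + \<delta>" by (intro least G(2)) auto
    qed
  qed
  ultimately show ?thesis by (rule that)
qed

text \<open>Here \<mu> = 1/N. The averaging lemma puts a point that survives one derivation at scale
  \<open>2 k \<epsilon>\<close> into the set \<open>k\<close> levels later, and \<sigma> is chosen
  so that an oscillation of \<open>2 \<epsilon>\<close> costs exactly one \<mu>.\<close>

lemma Cz_imp_asymptotically_flat:
  fixes \<epsilon> :: real
  assumes Cz: "Cz TYPE('a::banach) \<epsilon> \<le> enat N" and \<epsilon>: "\<epsilon> > 0" and N: "N > 0"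
  obtains F :: "'a::banach \<Rightarrow> real" where "\<And>x. norm x \<le> F x" "F 0 \<le> 1"
    "asymptotically_flat F (1 / (2 * \<epsilon> * real N)) (1 / real N)"
proof (rule asymptotically_flat_function)
  let ?K = "\<lambda>j. (convex_szlenk_derivation \<epsilon> ^^ j) (dual_unit_ball :: ('a \<Rightarrow>\<^sub>L real) set)"
  note props = convex_szlenk_iterate_props[OF dual_unit_ball_props]
  show "?K 0 = dual_unit_ball" by simp
  show KN: "?K j = {}" if "N \<le> j" for j
    using order_trans[OF Cz, of "enat j"] that by (simp add: Cz_le_iff)
  show "?K j \<subseteq> dual_unit_ball" for j by (rule props(3))
  show "closedin weak_star_topology (?K j)" for j by (rule props(2))
  fix j and f :: "'a \<Rightarrow>\<^sub>L real" assume f: "f \<in> ?K j"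
  have later: "szlenk_derivation (2 * real k * \<epsilon>) (?K j) \<subseteq> ?K (j + k)" if "k > 0" for k
  proof -
    have "?K (j + k) = (convex_szlenk_derivation \<epsilon> ^^ k) (?K j)"
      by (metis add.commute comp_apply funpow_add)
    then show ?thesis using szlenk_derivation_subset_iterate[OF props(1,2,4) that] by metis
  qed
  \<comment> \<open>For the least \<open>k\<close> with \<open>P k\<close>, the point
    \<open>f\<close> lies \<open>k\<close> levels later, yet has a neighbourhood of diameter at most
    \<open>2 (k + 1) \<epsilon>\<close>; the extra unit is the error \<eta> = 1/N. Such a
    \<open>k\<close> exists because the levels from \<open>N\<close> on are empty.\<close>
  define P where "P k \<longleftrightarrow> f \<notin> szlenk_derivation (2 * real (Suc k) * \<epsilon>) (?K j)" for k
  have "P N" using later[of "Suc N"] KN[of "j + Suc N"] by (auto simp: P_def)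
  then have "P (LEAST k. P k)" by (rule LeastI)
  moreover define k where "k = (LEAST k. P k)"
  ultimately have Pk: "f \<notin> szlenk_derivation (2 * real (Suc k) * \<epsilon>) (?K j)" by (simp add: P_def)
  have fk: "f \<in> ?K (j + k)"
  proof (cases k)
    case (Suc k')
    then have "\<not> P k'" using not_less_Least[of k' P] by (simp add: k_def)
    then show ?thesis using later[of k] Suc by (auto simp: P_def)
  qed (use f in simp)
  obtain V where V: "openin weak_star_topology V" "f \<in> V"
    "diameter (V \<inter> ?K j) \<le> 2 * real (Suc k) * \<epsilon>"
    using not_in_szlenk_derivation[OF f Pk] by blast
  have "1 / (2 * \<epsilon> * real N) * diameter (V \<inter> ?K j) \<le> 1 / (2 * \<epsilon> * real N) * (2 * real (Suc k) * \<epsilon>)"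
    using V(3) \<epsilon> by (intro mult_left_mono) auto
  also have "\<dots> = real k * (1 / real N) + 1 / real N" using \<epsilon> N by (simp add: field_simps)
  finally show "\<exists>k V. f \<in> ?K (j + k) \<and> openin weak_star_topology V \<and> f \<in> V \<and>
      1 / (2 * \<epsilon> * real N) * diameter (V \<inter> ?K j) \<le> real k * (1 / real N) + 1 / real N"
    using fk V by blast
qed (use N that in auto)

text \<open>For plain derivations only \<open>k = 0\<close> and \<open>k = 1\<close> are used: a
  point that survives the next derivation pays for the trivial diameter bound 2 with one \<mu> =
  1/N, any other point has a neighbourhood of diameter at most \<epsilon>.\<close>

lemma Sz_imp_asymptotically_flat:
  fixes \<epsilon> :: real
  assumes Sz: "(szlenk_derivation \<epsilon> ^^ N) (dual_unit_ball :: ('a::banach \<Rightarrow>\<^sub>L real) set) = {}"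
    and \<epsilon>: "\<epsilon> > 0"
  obtains F :: "'a::banach \<Rightarrow> real" where "\<And>x. norm x \<le> F x" "F 0 \<le> 1"
    "asymptotically_flat F (1 / (2 * real N)) (\<epsilon> / (2 * real N))"
proof (rule asymptotically_flat_function)
  let ?K = "\<lambda>j. (szlenk_derivation \<epsilon> ^^ j) (dual_unit_ball :: ('a \<Rightarrow>\<^sub>L real) set)"
  show "?K 0 = dual_unit_ball" by simp
  show "?K j = {}" if "N \<le> j" for j
    using that Sz
  proof (induction rule: dec_induct)
    case (step n)
    then show ?case using szlenk_derivation_subset[of \<epsilon> "?K n"] by simp
  qed
  show sub: "?K j \<subseteq> dual_unit_ball" for j
    by (induction j) (use szlenk_derivation_subset in auto)
  show "closedin weak_star_topology (?K j)" for j
    by (induction j) (auto intro: closedin_dual_unit_ball closedin_szlenk_derivation)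
  fix j and f :: "'a \<Rightarrow>\<^sub>L real" assume f: "f \<in> ?K j"
  have N: "N > 0" using Sz by (cases N) auto
  show "\<exists>k V. f \<in> ?K (j + k) \<and> openin weak_star_topology V \<and> f \<in> V \<and>
      1 / (2 * real N) * diameter (V \<inter> ?K j) \<le> real k * (1 / real N) + \<epsilon> / (2 * real N)"
  proof (cases "f \<in> szlenk_derivation \<epsilon> (?K j)")
    case True
    have "diameter (UNIV \<inter> ?K j) \<le> 2"
    proof (rule diameter_le)
      fix g h assume "g \<in> UNIV \<inter> ?K j" "h \<in> UNIV \<inter> ?K j"
      then have "norm g \<le> 1" "norm h \<le> 1" using sub[of j] by auto
      then show "norm (g - h) \<le> 2" using norm_triangle_ineq4[of g h] by linarith
    qed simp
    then have "1 / (2 * real N) * diameter (UNIV \<inter> ?K j) \<le> 1 / (2 * real N) * 2"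
      by (intro mult_left_mono) auto
    also have "\<dots> \<le> real 1 * (1 / real N) + \<epsilon> / (2 * real N)" using \<epsilon> N by simp
    finally show ?thesis
      using True openin_topspace[of "weak_star_topology :: ('a \<Rightarrow>\<^sub>L real) topology"]
      by (intro exI[of _ 1] exI[of _ UNIV]) (auto simp: strong_operator_topology_topspace)
  next
    case False
    then obtain V where V: "openin weak_star_topology V" "f \<in> V" "diameter (V \<inter> ?K j) \<le> \<epsilon>"
      using not_in_szlenk_derivation[OF f] by blast
    have "1 / (2 * real N) * diameter (V \<inter> ?K j) \<le> 1 / (2 * real N) * \<epsilon>"
      using V(3) by (intro mult_left_mono) auto
    then show ?thesis using f V by (intro exI[of _ 0] exI[of _ V]) auto
  qed
next
  show "real N * (1 / real N) \<le> 1" by simp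
next
  fix F :: "'a \<Rightarrow> real"
  assume "\<And>x. norm x \<le> F x" "F 0 \<le> 1" "asymptotically_flat F (1 / (2 * real N)) (\<epsilon> / (2 * real N))"
  then show thesis by (rule that)
qed simp

subsection \<open>The Gorelik principle\<close>

text \<open>Only points of the grid occur, and the grid depends on the modulus of continuity alone; this
  makes the sets of grid points below finite and independent of the map.\<close>

lemma approximate_brouwer_grid:
  fixes h :: "(nat \<Rightarrow> real) \<Rightarrow> nat \<Rightarrow> real" and p n :: nat
  assumes p: "0 < p"
    and range: "\<And>x i. i < n \<Longrightarrow> h x i \<in> {0..1}"
    and cont: "\<And>x y i. (\<And>j. j < n \<Longrightarrow> x j \<in> {0..1}) \<Longrightarrow> (\<And>j. j < n \<Longrightarrow> y j \<in> {0..1}) \<Longrightarrow>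
      (\<And>j. j < n \<Longrightarrow> \<bar>x j - y j\<bar> \<le> 1 / real p) \<Longrightarrow> i < n \<Longrightarrow> \<bar>h x i - h y i\<bar> \<le> e"
  obtains q :: "nat \<Rightarrow> nat" where "\<And>i. i < n \<Longrightarrow> q i < p"
    "\<And>i. i < n \<Longrightarrow> \<bar>h (\<lambda>i. real (q i) / real p) i - real (q i) / real p\<bar> \<le> e + 1 / real p"
proof -
  define g where "g q = (\<lambda>i. real (q i) / real p)" for q :: "nat \<Rightarrow> nat"
  \<comment> \<open>Label 0 marks coordinates that the map does not lower, label 1 the others; on
    the far face \<open>q i = p\<close> the label is set to 1, as Kuhn's lemma demands.\<close>
  define label where "label q i = (if h (g q) i \<ge> g q i \<and> q i \<noteq> p then 0 else 1 :: nat)" for q i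
  obtain q where q: "\<forall>i<n. q i < p"
    and rs: "\<forall>i<n. \<exists>r s. (\<forall>j<n. q j \<le> r j \<and> r j \<le> q j + 1) \<and>
      (\<forall>j<n. q j \<le> s j \<and> s j \<le> q j + 1) \<and> label r i \<noteq> label s i"
  proof (rule kuhn_lemma[OF p, of n label])
    show "\<forall>x. (\<forall>i<n. x i \<le> p) \<longrightarrow> (\<forall>i<n. label x i = 0 \<or> label x i = 1)"
      by (auto simp: label_def)
    show "\<forall>x. (\<forall>i<n. x i \<le> p) \<longrightarrow> (\<forall>i<n. x i = 0 \<longrightarrow> label x i = 0)"
      using range p by (auto simp: label_def g_def)
    show "\<forall>x. (\<forall>i<n. x i \<le> p) \<longrightarrow> (\<forall>i<n. x i = p \<longrightarrow> label x i = 1)"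
      by (auto simp: label_def)
  qed
  have main: "\<bar>h (g q) i - g q i\<bar> \<le> e + 1 / real p" if i: "i < n" for i
  proof -
    have near: "\<bar>h (g q) i - h (g r) i\<bar> \<le> e \<and> g q i \<le> g r i \<and> g r i \<le> g q i + 1 / real p"
      if r: "\<forall>j<n. q j \<le> r j \<and> r j \<le> q j + 1" for r
    proof -
      have le: "g q j \<le> g r j \<and> g r j \<le> g q j + 1 / real p \<and> g q j \<in> {0..1} \<and> g r j \<in> {0..1}"
        if "j < n" for j
      proof -
        have "q j \<le> r j" "r j \<le> q j + 1" "q j < p" using r q that by auto
        then have "real (q j) \<le> real (r j)" "real (r j) \<le> real (q j) + 1" "real (r j) \<le> real p"
          by linarith+
        then show ?thesis using p by (auto simp: g_def divide_simps)
      qed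
      then have "\<bar>g q j - g r j\<bar> \<le> 1 / real p" if "j < n" for j using that by fastforce
      then show ?thesis using le i cont[of "g q" "g r" i] by blast
    qed
    \<comment> \<open>Kuhn's lemma supplies two corners of the cell at \<open>q\<close> with
      different labels in coordinate \<open>i\<close>. Label 0 bounds \<open>h\<close> from below,
      label 1 from above; passing to \<open>q\<close> costs \<open>e\<close> and one mesh
      width.\<close>
    have lo: "h (g q) i \<ge> g q i - e - 1 / real p"
      if r: "\<forall>j<n. q j \<le> r j \<and> r j \<le> q j + 1" and "label r i = 0" for r
    proof -
      have "h (g r) i \<ge> g r i" using that(2) by (auto simp: label_def split: if_splits)
      moreover have "1 / real p \<ge> 0" by simp
      ultimately show ?thesis using near[OF r] by linarith
    qed
    have hi: "h (g q) i \<le> g q i + e + 1 / real p"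
      if s: "\<forall>j<n. q j \<le> s j \<and> s j \<le> q j + 1" and "label s i = 1" for s
    proof -
      \<comment> \<open>If the label is 1 because \<open>s i = p\<close>, then
        \<open>g s i = 1\<close> and the inequality follows from the range of
        \<open>h\<close>.\<close>
      have "h (g s) i \<le> g s i"
        using that(2) range[OF i, of "g s"] p by (auto simp: label_def g_def split: if_splits)
      then show ?thesis using near[OF s] by linarith
    qed
    obtain r s where r: "\<forall>j<n. q j \<le> r j \<and> r j \<le> q j + 1"
      and s: "\<forall>j<n. q j \<le> s j \<and> s j \<le> q j + 1" and ne: "label r i \<noteq> label s i"
      using rs i by blast
    consider "label r i = 0" "label s i = 1" | "label r i = 1" "label s i = 0"
      using ne by (auto simp: label_def split: if_splits)
    then show ?thesis
    proof cases
      case 1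
      then show ?thesis using lo[OF r] hi[OF s] by linarith
    next
      case 2
      then show ?thesis using lo[OF s] hi[OF r] by linarith
    qed
  qed
  show ?thesis
    by (rule that[of q]) (use q main in \<open>auto simp: g_def\<close>)
qed

text \<open>The integer parts of the numbers \<open>f x / \<kappa>\<close> form finitely many
  patterns on the ball; one representative of each pattern gives the net.\<close>

lemma finite_net_functionals:
  fixes S :: "('a::real_normed_vector \<Rightarrow>\<^sub>L real) set" and \<kappa> d :: real
  assumes S: "finite S" and "\<kappa> > 0"
  obtains D :: "'a set" where "finite D" "D \<subseteq> cball 0 d"
    "\<And>x::'a. x \<in> cball 0 d \<Longrightarrow> \<exists>u\<in>D. \<forall>f\<in>S. \<bar>blinfun_apply f x - blinfun_apply f u\<bar> < \<kappa>"
proof -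
  define c where "c x = (\<lambda>f\<in>S. \<lfloor>blinfun_apply f x / \<kappa>\<rfloor>)" for x
  have "c ` cball 0 d \<subseteq> (\<Pi>\<^sub>E f\<in>S. {\<lfloor>- (norm f * d) / \<kappa>\<rfloor>..\<lfloor>norm f * d / \<kappa>\<rfloor>})"
  proof (intro image_subsetI PiE_I)
    fix x :: 'a and f assume x: "x \<in> cball 0 d" and f: "f \<in> S"
    have "\<bar>blinfun_apply f x\<bar> \<le> norm f * d"
      using norm_blinfun[of f x] mult_left_mono[of "norm x" d "norm f"] x by auto
    then have "- (norm f * d) \<le> blinfun_apply f x" "blinfun_apply f x \<le> norm f * d" by auto
    then show "c x f \<in> {\<lfloor>- (norm f * d) / \<kappa>\<rfloor>..\<lfloor>norm f * d / \<kappa>\<rfloor>}"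
      using f \<open>\<kappa> > 0\<close> divide_right_mono[of "- (norm f * d)" "blinfun_apply f x" \<kappa>]
        divide_right_mono[of "blinfun_apply f x" "norm f * d" \<kappa>]
      by (simp add: c_def floor_mono)
  qed (auto simp: c_def)
  then have "finite (c ` cball 0 d)"
    using S by (meson finite_PiE finite_atLeastAtMost_int finite_subset)
  then obtain D where D: "D \<subseteq> cball 0 d" "finite D" "c ` cball 0 d = c ` D"
    by (meson finite_subset_image order_refl)
  show ?thesis
  proof (rule that[OF D(2,1)])
    fix x :: 'a assume "x \<in> cball 0 d"
    then obtain u where u: "u \<in> D" "c x = c u" using D(3) by (metis imageE imageI)
    have "\<bar>blinfun_apply f x - blinfun_apply f u\<bar> < \<kappa>" if "f \<in> S" for f
    proof -
      have "\<lfloor>blinfun_apply f x / \<kappa>\<rfloor> = \<lfloor>blinfun_apply f u / \<kappa>\<rfloor>"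
        using fun_cong[OF u(2), of f] that by (simp add: c_def)
      then have "\<bar>blinfun_apply f x / \<kappa> - blinfun_apply f u / \<kappa>\<bar> < 1" by linarith
      then have "\<bar>blinfun_apply f x - blinfun_apply f u\<bar> / \<kappa> < 1"
        using \<open>\<kappa> > 0\<close> by (simp add: diff_divide_distrib[symmetric])
      then show ?thesis using \<open>\<kappa> > 0\<close> by simp
    qed
    then show "\<exists>u\<in>D. \<forall>f\<in>S. \<bar>blinfun_apply f x - blinfun_apply f u\<bar> < \<kappa>" using u by blast
  qed
qed

lemma abs_blinfun_diff_le:
  fixes f :: "'a::real_normed_vector \<Rightarrow>\<^sub>L real"
  shows "\<bar>blinfun_apply f x - blinfun_apply f y\<bar> \<le> norm f * norm (x - y)"
  using norm_blinfun[of f "x - y"] by (simp add: blinfun.diff_right)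

text \<open>The \<open>\<psi> i\<close> are the weights of a Schauder projection.\<close>

lemma schauder_weights:
  fixes S :: "('a::real_normed_vector \<Rightarrow>\<^sub>L real) set" and \<kappa> d :: real
  assumes S: "finite S" and "\<kappa> > 0" and d: "d \<ge> 0"
  obtains n :: nat and u :: "nat \<Rightarrow> 'a" and \<psi> :: "nat \<Rightarrow> 'a \<Rightarrow> real" and \<Lambda> :: real where
    "\<And>i. i < n \<Longrightarrow> norm (u i) \<le> d" "\<Lambda> \<ge> 0"
    "\<And>(x::'a) i. norm x \<le> d \<Longrightarrow> i < n \<Longrightarrow> \<psi> i x \<ge> 0"
    "\<And>x::'a. norm x \<le> d \<Longrightarrow> (\<Sum>i<n. \<psi> i x) = 1"
    "\<And>(x::'a) y i. norm x \<le> d \<Longrightarrow> norm y \<le> d \<Longrightarrow> i < n \<Longrightarrow> \<bar>\<psi> i x - \<psi> i y\<bar> \<le> \<Lambda> * norm (x - y)"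
    "\<And>(x::'a) f. norm x \<le> d \<Longrightarrow> f \<in> S \<Longrightarrow> \<bar>blinfun_apply f (\<Sum>i<n. \<psi> i x *\<^sub>R u i) - blinfun_apply f x\<bar> \<le> \<kappa>"
proof -
  \<comment> \<open>Chosen so that \<open>card S\<close> deviations below \<open>k\<close> add up to
    at most \<kappa>/2.\<close>
  define k where "k = \<kappa> / (2 * (real (card S) + 1))"
  have k: "k > 0" "k * (2 * (real (card S) + 1)) = \<kappa>" using \<open>\<kappa> > 0\<close> by (auto simp: k_def)
  obtain D where D: "finite D" "D \<subseteq> cball (0::'a) d"
    "\<And>x. x \<in> cball 0 d \<Longrightarrow> \<exists>u\<in>D. \<forall>f\<in>S. \<bar>blinfun_apply f x - blinfun_apply f u\<bar> < k"
    using finite_net_functionals[OF S k(1)] by blast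
  define n where "n = card D"
  obtain u where u: "bij_betw u {..<n} D"
    using ex_bij_betw_nat_finite[OF D(1)] by (auto simp: n_def atLeast0LessThan)
  define \<rho> where "\<rho> i x = (\<Sum>f\<in>S. \<bar>blinfun_apply f x - blinfun_apply f (u i)\<bar>)" for i x
  define N where "N i x = max 0 (\<kappa> - \<rho> i x)" for i x
  define T where "T x = (\<Sum>i<n. N i x)" for x
  define \<Lambda> where "\<Lambda> = (\<Sum>f\<in>S. norm f)"
  have \<Lambda>: "\<Lambda> \<ge> 0" by (simp add: \<Lambda>_def sum_nonneg)
  have N0: "N i x \<ge> 0" for i x by (simp add: N_def)
  have N_le: "N i x \<le> T x" if "i < n" for i x
    unfolding T_def using that by (intro member_le_sum) (auto simp: N0)
  \<comment> \<open>The net puts some node within \<kappa>/2 of every point of the ball; this lower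
    bound on the normalizer makes the quotients Lipschitz.\<close>
  have T_ge: "T x \<ge> \<kappa> / 2" if x: "norm x \<le> d" for x
  proof -
    obtain w where w: "w \<in> D" "\<forall>f\<in>S. \<bar>blinfun_apply f x - blinfun_apply f w\<bar> < k" using D(3)[of x] x by auto
    obtain i where i: "i < n" "w = u i" using u w(1) by (auto simp: bij_betw_def)
    have "\<rho> i x \<le> (\<Sum>f\<in>S. k)" unfolding \<rho>_def using w(2) i by (intro sum_mono) auto
    also have "\<dots> \<le> \<kappa> / 2" using k by (simp add: algebra_simps)
    finally show ?thesis using N_le[OF i(1), of x] by (simp add: N_def)
  qed
  have Nlip: "\<bar>N i x - N i y\<bar> \<le> \<Lambda> * norm (x - y)" for i x y
  proof -
    have "\<bar>\<rho> i x - \<rho> i y\<bar> \<le> (\<Sum>f\<in>S. norm f * norm (x - y))"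
      unfolding \<rho>_def sum_subtractf[symmetric]
    proof (rule order_trans[OF sum_abs], rule sum_mono)
      fix f :: "'a \<Rightarrow>\<^sub>L real"
      show "\<bar>\<bar>blinfun_apply f x - blinfun_apply f (u i)\<bar> - \<bar>blinfun_apply f y - blinfun_apply f (u i)\<bar>\<bar> \<le> norm f * norm (x - y)"
        using abs_blinfun_diff_le[of f x y] by linarith
    qed
    then have "\<bar>\<rho> i x - \<rho> i y\<bar> \<le> \<Lambda> * norm (x - y)" by (simp add: \<Lambda>_def sum_distrib_right)
    then show ?thesis unfolding N_def by linarith
  qed
  have Tlip: "\<bar>T x - T y\<bar> \<le> real n * (\<Lambda> * norm (x - y))" for x y
  proof -
    have "\<bar>T x - T y\<bar> \<le> (\<Sum>i<n. \<bar>N i x - N i y\<bar>)"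
      unfolding T_def sum_subtractf[symmetric] by (rule sum_abs)
    also have "\<dots> \<le> (\<Sum>i<n. \<Lambda> * norm (x - y))" by (intro sum_mono Nlip)
    finally show ?thesis by simp
  qed
  define \<psi> where "\<psi> i x = N i x / T x" for i x
  have T_pos: "T x > 0" if "norm x \<le> d" for x using T_ge[OF that] \<open>\<kappa> > 0\<close> by linarith
  show ?thesis
  proof (rule that[where n = n and u = u and \<psi> = \<psi> and \<Lambda> = "2 / \<kappa> * (\<Lambda> + real n * \<Lambda>)"])
    show "norm (u i) \<le> d" if "i < n" for i
      using u D(2) that by (auto simp: bij_betw_def)
    show "2 / \<kappa> * (\<Lambda> + real n * \<Lambda>) \<ge> 0" using \<Lambda> \<open>\<kappa> > 0\<close> by simp
    fix x :: 'a assume x: "norm x \<le> d"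
    show \<psi>0: "\<psi> i x \<ge> 0" if "i < n" for i
      using N0 T_pos[OF x] by (simp add: \<psi>_def)
    show \<psi>1: "(\<Sum>i<n. \<psi> i x) = 1"
      using T_pos[OF x] by (simp add: \<psi>_def sum_divide_distrib[symmetric] T_def[symmetric])
    show "\<bar>\<psi> i x - \<psi> i y\<bar> \<le> 2 / \<kappa> * (\<Lambda> + real n * \<Lambda>) * norm (x - y)"
      if y: "norm y \<le> d" and i: "i < n" for i y
    proof -
      have Tx: "T x > 0" and Ty: "T y > 0" using T_pos x y by auto
      have "\<psi> i x - \<psi> i y = ((N i x - N i y) * T y + N i y * (T y - T x)) / (T x * T y)"
        using Tx Ty by (simp add: \<psi>_def field_simps)
      also have "\<bar>\<dots>\<bar> \<le> (\<bar>N i x - N i y\<bar> * T y + T y * \<bar>T y - T x\<bar>) / (T x * T y)"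
      proof -
        have "\<bar>(N i x - N i y) * T y + N i y * (T y - T x)\<bar>
            \<le> \<bar>N i x - N i y\<bar> * T y + N i y * \<bar>T y - T x\<bar>"
          using abs_triangle_ineq[of "(N i x - N i y) * T y" "N i y * (T y - T x)"] Ty N0[of i y]
          by (simp add: abs_mult)
        also have "\<dots> \<le> \<bar>N i x - N i y\<bar> * T y + T y * \<bar>T y - T x\<bar>"
          using N_le[OF i, of y] by (intro add_left_mono mult_right_mono) auto
        finally show ?thesis using Tx Ty by (simp add: divide_right_mono)
      qed
      also have "\<dots> = (\<bar>N i x - N i y\<bar> + \<bar>T y - T x\<bar>) / T x"
        using Tx Ty by (simp add: field_simps)
      also have "\<dots> \<le> (\<Lambda> * norm (x - y) + real n * (\<Lambda> * norm (x - y))) / (\<kappa> / 2)"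
        using Nlip[of i x y] Tlip[of x y] T_ge[OF x] \<open>\<kappa> > 0\<close> \<Lambda>
        by (intro frac_le) (auto simp: abs_minus_commute)
      finally show ?thesis by (simp add: field_simps)
    qed
    show "\<bar>blinfun_apply f (\<Sum>i<n. \<psi> i x *\<^sub>R u i) - blinfun_apply f x\<bar> \<le> \<kappa>" if f: "f \<in> S" for f
    proof -
      have "blinfun_apply f (\<Sum>i<n. \<psi> i x *\<^sub>R u i) - blinfun_apply f x =
          (\<Sum>i<n. \<psi> i x * (blinfun_apply f (u i) - blinfun_apply f x))"
        using \<psi>1 by (simp add: blinfun.sum_right blinfun.scaleR_right right_diff_distrib sum_subtractf
            sum_distrib_right[symmetric])
      also have "\<bar>\<dots>\<bar> \<le> (\<Sum>i<n. \<psi> i x * \<kappa>)"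
      proof (rule order_trans[OF sum_abs], rule sum_mono)
        fix i assume i: "i \<in> {..<n}"
        show "\<bar>\<psi> i x * (blinfun_apply f (u i) - blinfun_apply f x)\<bar> \<le> \<psi> i x * \<kappa>"
        \<comment> \<open>Only nodes with \<rho> at most \<kappa> carry weight, so each value
          averaged is off by at most \<kappa>.\<close>
        proof (cases "N i x = 0")
          case False
          then have "\<rho> i x \<le> \<kappa>" by (auto simp: N_def max_def split: if_splits)
          moreover have "\<bar>blinfun_apply f x - blinfun_apply f (u i)\<bar> \<le> \<rho> i x"
            unfolding \<rho>_def using S f by (intro member_le_sum) auto
          ultimately have "\<bar>blinfun_apply f (u i) - blinfun_apply f x\<bar> \<le> \<kappa>" by (simp add: abs_minus_commute)
          then show ?thesis using \<psi>0[of i] i by (simp add: abs_mult mult_left_mono)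
        qed (simp add: \<psi>_def)
      qed
      finally show ?thesis using \<psi>1 by (simp add: sum_distrib_right[symmetric])
    qed
  qed
qed

text \<open>The Gorelik principle, for a weak neighbourhood of zero in place of a subspace of finite
  codimension.\<close>

lemma gorelik_principle:
  fixes U :: "'a::real_normed_vector \<Rightarrow> 'b::real_normed_vector"
    and S :: "('a \<Rightarrow>\<^sub>L real) set" and \<kappa> b d D :: real
  assumes bij: "bij U" and ucU: "uniformly_continuous_on UNIV U"
    and ucV: "uniformly_continuous_on UNIV (inv U)"
    and mod: "\<And>x x'. norm (U x - U x') \<le> b \<Longrightarrow> norm (x - x') \<le> d"
    and b: "b \<ge> 0" and d: "d \<ge> 0" "2 * d < D"
    and S: "finite S" and \<kappa>: "\<kappa> > 0"
  obtains A where "finite A"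
    "\<And>v. norm v \<le> b \<Longrightarrow> \<exists>a\<in>A. \<exists>w. v = U (c + w) - U a \<and> norm w \<le> D \<and>
      (\<forall>f\<in>S. \<bar>blinfun_apply f w\<bar> \<le> \<kappa>)"
proof -
  obtain n :: nat and u :: "nat \<Rightarrow> 'a" and \<psi> \<Lambda> where u: "\<And>i. i < n \<Longrightarrow> norm (u i) \<le> d" and \<Lambda>: "\<Lambda> \<ge> 0"
    and \<psi>0: "\<And>(x::'a) i. norm x \<le> d \<Longrightarrow> i < n \<Longrightarrow> \<psi> i x \<ge> 0"
    and \<psi>1: "\<And>x::'a. norm x \<le> d \<Longrightarrow> (\<Sum>i<n. \<psi> i x) = 1"
    and \<psi>_lip: "\<And>x y i. norm x \<le> d \<Longrightarrow> norm y \<le> d \<Longrightarrow> i < n \<Longrightarrow> \<bar>\<psi> i x - \<psi> i y\<bar> \<le> \<Lambda> * norm (x - y)"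
    and \<psi>S: "\<And>x f. norm x \<le> d \<Longrightarrow> f \<in> S \<Longrightarrow>
      \<bar>blinfun_apply f (\<Sum>i<n. \<psi> i x *\<^sub>R u i) - blinfun_apply f x\<bar> \<le> \<kappa> / 2"
    by (rule schauder_weights[OF S half_gt_zero[OF \<kappa>] d(1)]) (rule that; assumption)
  define V where "V = inv U"
  have UV: "U (V y) = y" and VU: "V (U x) = x" for x y
    using bij by (simp_all add: V_def bij_def surj_f_inv_f)
  define P where "P t = (\<Sum>i<n. t i *\<^sub>R u i)" for t :: "nat \<Rightarrow> real"
  \<comment> \<open>Dominates both \<open>d\<close> and all \<open>norm f * d\<close>, so that one
    choice of \<open>e\<close> controls the norm of \<open>w\<close> and its values on
    \<open>S\<close>.\<close>
  define M where "M = 1 + d + (\<Sum>f\<in>S. norm f * d)"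
  have fM: "norm f * d \<le> M" if "f \<in> S" for f
    using member_le_sum[of f S "\<lambda>f. norm f * d"] S that d(1) by (auto simp: M_def)
  have M: "M \<ge> 1" "M \<ge> d" using d(1) by (auto simp: M_def intro!: sum_nonneg add_nonneg_nonneg)
  define \<beta> where "\<beta> = min \<kappa> (D - 2 * d)"
  have \<beta>: "\<beta> > 0" "\<beta> \<le> \<kappa>" "\<beta> \<le> D - 2 * d" using \<kappa> d by (auto simp: \<beta>_def)
  define e where "e = \<beta> / (4 * (real n + 1) * M)"
  have e: "e > 0" using \<beta> M by (simp add: e_def)
  have ebound: "real n * (2 * e) * M \<le> \<beta> / 2"
  proof -
    have "4 * (real n + 1) * M \<noteq> 0" using M by simp
    then have "e * (4 * (real n + 1) * M) = \<beta>" unfolding e_def by (rule nonzero_eq_divide_eq[THEN iffD1]) simp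
    then have "2 * e * M * (real n + 1) = \<beta> / 2" by (simp add: algebra_simps)
    moreover have "real n * (2 * e) * M \<le> 2 * e * M * (real n + 1)" using e M by (simp add: algebra_simps)
    ultimately show ?thesis by linarith
  qed
  have P_dist: "norm (P s - P t) \<le> real n * \<eta> * d" if "\<And>i. i < n \<Longrightarrow> \<bar>s i - t i\<bar> \<le> \<eta>" for s t \<eta>
  proof -
    have "norm (P s - P t) \<le> (\<Sum>i<n. norm ((s i - t i) *\<^sub>R u i))"
      unfolding P_def sum_subtractf[symmetric] scaleR_diff_left[symmetric] by (rule norm_sum)
    also have "\<dots> \<le> (\<Sum>i<n. \<eta> * d)"
      using that u d(1) by (intro sum_mono) (auto intro!: mult_mono order_trans[OF abs_ge_zero that])
    finally show ?thesis by simp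
  qed
  \<comment> \<open>For every \<open>a\<close>, the vector \<open>w = a - g v a\<close> solves
    \<open>v = U (c + w) - U (c + a)\<close>. An approximate fixed point of the Schauder projection
    of \<open>g v\<close> makes \<open>a\<close> and \<open>g v a\<close> nearly agree on
    \<open>S\<close>, hence \<open>w\<close> weakly small.\<close>
  define g where "g v a = a - (V (v + U (c + a)) - c)" for v and a :: 'a
  have g_le: "norm (g v a) \<le> d" if "norm v \<le> b" for v and a :: 'a
    using mod[of "V (v + U (c + a))" "c + a"] that
    by (simp add: g_def UV norm_minus_commute algebra_simps)
  \<comment> \<open>The radius does not depend on \<open>v\<close>: adding \<open>v\<close> is a
    translation and leaves the modulus of \<open>inv U\<close> unchanged. Hence one grid serves all
    \<open>v\<close>.\<close>
  obtain r where r: "r > 0" "\<And>v (a::'a) a'. norm (a - a') < r \<Longrightarrow> \<Lambda> * norm (g v a - g v a') \<le> e"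
  proof -
    have pos: "e / (2 * (\<Lambda> + 1)) > 0" using e \<Lambda> by simp
    obtain r1 where r1: "r1 > 0" "\<And>y y'. dist y' y < r1 \<Longrightarrow> dist (V y') (V y) < e / (2 * (\<Lambda> + 1))"
      using ucV pos unfolding uniformly_continuous_on_def V_def by (metis UNIV_I)
    obtain r2 where r2: "r2 > 0" "\<And>x x'. dist x' x < r2 \<Longrightarrow> dist (U x') (U x) < r1"
      using ucU r1(1) unfolding uniformly_continuous_on_def by (metis UNIV_I)
    show ?thesis
    proof (rule that[of "min r2 (e / (2 * (\<Lambda> + 1)))"])
      show "min r2 (e / (2 * (\<Lambda> + 1))) > 0" using r2(1) pos by simp
      fix v and a a' :: 'a assume a: "norm (a - a') < min r2 (e / (2 * (\<Lambda> + 1)))"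
      have "dist (U (c + a)) (U (c + a')) < r1" using a by (intro r2(2)) (simp add: dist_norm)
      then have "dist (V (v + U (c + a))) (V (v + U (c + a'))) < e / (2 * (\<Lambda> + 1))"
        by (intro r1(2)) (simp add: dist_norm)
      then have "norm (V (v + U (c + a)) - V (v + U (c + a'))) < e / (2 * (\<Lambda> + 1))"
        by (simp add: dist_norm)
      moreover have "norm (g v a - g v a') \<le> norm (a - a') + norm (V (v + U (c + a)) - V (v + U (c + a')))"
        using norm_triangle_ineq4[of "a - a'" "V (v + U (c + a)) - V (v + U (c + a'))"]
        by (simp add: g_def algebra_simps)
      moreover have "norm (a - a') < e / (2 * (\<Lambda> + 1))" using a by linarith
      ultimately have "norm (g v a - g v a') \<le> 2 * (e / (2 * (\<Lambda> + 1)))"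
        by linarith
      also have "\<dots> = e / (\<Lambda> + 1)"
        by (metis mult_divide_mult_cancel_left times_divide_eq_right zero_neq_numeral)
      finally have "norm (g v a - g v a') \<le> e / (\<Lambda> + 1)" .
      then have "\<Lambda> * norm (g v a - g v a') \<le> (\<Lambda> + 1) * (e / (\<Lambda> + 1))"
        using \<Lambda> by (intro mult_mono) auto
      then show "\<Lambda> * norm (g v a - g v a') \<le> e" using \<Lambda> by simp
    qed
  qed
  \<comment> \<open>Fine enough for \<open>1 / p\<close> \<le> \<open>e\<close> and for neighbouring
    grid vectors to give points closer than \<open>r\<close>.\<close>
  define p where "p = nat \<lceil>1 / e + real n * d / r\<rceil> + 1"
  have "real p > 1 / e + real n * d / r" unfolding p_def by linarith
  moreover have "1 / e > 0" "real n * d / r \<ge> 0" using e r d by auto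
  moreover have "0 < p" by (simp add: p_def)
  ultimately have p: "0 < p" "real p > 1 / e" "real p > real n * d / r" by linarith+
  have pe: "1 / real p \<le> e" and pr: "real n * (1 / real p) * d < r"
    using p e r by (auto simp: field_simps)
  define A where "A = (\<lambda>q. c + P (\<lambda>i. real (q i) / real p)) ` (\<Pi>\<^sub>E i\<in>{..<n}. {..<p})"
  show ?thesis
  proof (rule that[of A])
    show "finite A" unfolding A_def by (intro finite_imageI finite_PiE) auto
    fix v :: 'b assume v: "norm v \<le> b"
    define h where "h t i = \<psi> i (g v (P t))" for t i
    have range: "h t i \<in> {0..1}" if "i < n" for t i
      using \<psi>0[OF g_le[OF v] that] \<psi>1[OF g_le[OF v]] that
        member_le_sum[of i "{..<n}" "\<lambda>i. \<psi> i (g v (P t))"] \<psi>0[OF g_le[OF v]]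
      by (auto simp: h_def)
    have cont: "\<bar>h s i - h t i\<bar> \<le> e"
      if "\<And>j. j < n \<Longrightarrow> \<bar>s j - t j\<bar> \<le> 1 / real p" and i: "i < n" for s t i
    proof -
      have "norm (P s - P t) \<le> real n * (1 / real p) * d" by (rule P_dist) (rule that(1))
      then have "norm (P s - P t) < r" using pr by linarith
      then have "\<Lambda> * norm (g v (P s) - g v (P t)) \<le> e" by (rule r)
      then show ?thesis using \<psi>_lip[OF g_le[OF v] g_le[OF v] i] unfolding h_def by (meson order_trans)
    qed
    obtain q where q: "\<And>i. i < n \<Longrightarrow> q i < p"
      "\<And>i. i < n \<Longrightarrow> \<bar>h (\<lambda>i. real (q i) / real p) i - real (q i) / real p\<bar> \<le> e + 1 / real p"
      by (rule approximate_brouwer_grid[of p n h e, OF p(1) range cont]) (assumption | rule that)+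
    define q' where "q' = restrict q {..<n}"
    define t where "t i = real (q' i) / real p" for i
    define a where "a = P t"
    have a_eq: "a = P (\<lambda>i. real (q i) / real p)"
      unfolding a_def P_def by (intro sum.cong) (auto simp: t_def q'_def)
    have t_h: "\<bar>\<psi> i (g v a) - t i\<bar> \<le> 2 * e" if "i < n" for i
      using q(2)[OF that] pe that by (simp add: h_def a_eq t_def q'_def)
    have g: "norm (g v a) \<le> d" by (rule g_le[OF v])
    define z where "z = P (\<lambda>i. \<psi> i (g v a))"
    have za: "norm (z - a) \<le> real n * (2 * e) * d" unfolding z_def a_def
      by (rule P_dist) (use t_h in \<open>simp add: a_def\<close>)
    have z: "norm z \<le> d"
    proof -
      have "norm z \<le> (\<Sum>i<n. \<psi> i (g v a) * d)"
        unfolding z_def P_def using u \<psi>0[OF g]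
        by (intro order_trans[OF norm_sum] sum_mono) (auto intro!: mult_left_mono)
      then show ?thesis using \<psi>1[OF g] by (simp add: sum_distrib_right[symmetric])
    qed
    define w where "w = a - g v a"
    have cw: "c + w = V (v + U (c + a))" by (simp add: w_def g_def)
    show "\<exists>a\<in>A. \<exists>w. v = U (c + w) - U a \<and> norm w \<le> D \<and> (\<forall>f\<in>S. \<bar>blinfun_apply f w\<bar> \<le> \<kappa>)"
    proof (intro bexI exI conjI ballI)
      show "c + a \<in> A"
        unfolding A_def a_def t_def by (rule image_eqI[of _ _ q']) (use q(1) in \<open>auto simp: q'_def\<close>)
      show "v = U (c + w) - U (c + a)" by (simp add: cw UV)
      have en: "0 \<le> real n * (2 * e)" using e by simp
      have "norm (z - a) \<le> \<beta> / 2"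
        using order_trans[OF za order_trans[OF mult_left_mono[OF M(2) en] ebound]] .
      then have "norm a \<le> d + \<beta> / 2" using z norm_triangle_sub[of a z] by (simp add: norm_minus_commute)
      then have "norm w \<le> d + \<beta> / 2 + d"
        using g norm_triangle_ineq4[of a "g v a"] unfolding w_def by linarith
      then show "norm w \<le> D" using \<beta> by linarith
      \<comment> \<open>The error on \<open>S\<close> has two halves: \<open>a\<close> against its
        Schauder image \<open>z\<close>, and \<open>z\<close> against \<open>g v a\<close>.\<close>
      fix f assume f: "f \<in> S"
      have "\<bar>blinfun_apply f a - blinfun_apply f z\<bar> \<le> norm f * norm (z - a)"
        using abs_blinfun_diff_le[of f a z] by (simp add: norm_minus_commute)
      also have "\<dots> \<le> norm f * (real n * (2 * e) * d)" using za by (intro mult_left_mono) auto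
      also have "\<dots> = real n * (2 * e) * (norm f * d)" by simp
      also have "\<dots> \<le> \<beta> / 2" using order_trans[OF mult_left_mono[OF fM[OF f] en] ebound] .
      also have "\<dots> \<le> \<kappa> / 2" using \<beta>(2) by simp
      finally have "\<bar>blinfun_apply f a - blinfun_apply f z\<bar> \<le> \<kappa> / 2" .
      moreover have "\<bar>blinfun_apply f z - blinfun_apply f (g v a)\<bar> \<le> \<kappa> / 2"
        using \<psi>S[OF g f] by (simp add: z_def P_def)
      ultimately show "\<bar>blinfun_apply f w\<bar> \<le> \<kappa>" unfolding w_def blinfun.diff_right by linarith
    qed
  qed
qed

subsection \<open>Transfer to the dual of the second space\<close>

text \<open>The function \<open>\<Phi>\<^sub>t\<close> of the outline. For linear \<open>U\<close>
  and \<open>t > 0\<close> it is the Fenchel conjugate of \<open>F\<close> composed with the adjoint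
  of \<open>U\<close>, so its dependence on \<open>t\<close> reflects nonlinearity.\<close>

definition conjugate_at_scale ::
  "('a::banach \<Rightarrow> 'b::banach) \<Rightarrow> ('a \<Rightarrow> real) \<Rightarrow> real \<Rightarrow> ('b \<Rightarrow>\<^sub>L real) \<Rightarrow> real" where
  "conjugate_at_scale U F t y =
    (SUP p. blinfun_apply y (U (fst p) - U (snd p)) / t - F ((1 / t) *\<^sub>R (fst p - snd p)))"

context
  fixes U :: "'a::banach \<Rightarrow> 'b::banach" and F :: "'a \<Rightarrow> real"
  assumes U_le: "\<And>x x'. norm (U x - U x') \<le> norm (x - x') + 1"
    and F_ge: "\<And>x. norm x \<le> F x" and F0: "F 0 \<le> 1"
begin

text \<open>The norm term cancels because \<open>F\<close> dominates the norm; the additive error of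
  \<open>U\<close> is divided by \<open>t\<close>.\<close>

lemma conjugate_term_le_one:
  assumes y: "y \<in> dual_unit_ball" and t: "t \<ge> 1"
  shows "blinfun_apply y (U x - U x') / t - F ((1 / t) *\<^sub>R (x - x')) \<le> 1"
proof -
  have "blinfun_apply y (U x - U x') \<le> norm (x - x') + 1"
    using dual_unit_ball_abs_le[OF y, of "U x - U x'"] U_le[of x x'] by linarith
  then have "blinfun_apply y (U x - U x') / t \<le> (norm (x - x') + 1) / t"
    using t by (intro divide_right_mono) auto
  moreover have "norm (x - x') / t \<le> F ((1 / t) *\<^sub>R (x - x'))"
    using F_ge[of "(1 / t) *\<^sub>R (x - x')"] t by simp
  moreover have "1 / t \<le> 1" using t by simp
  ultimately show ?thesis by (simp add: add_divide_distrib)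
qed

lemma conjugate_bdd_above:
  assumes "y \<in> dual_unit_ball" "t \<ge> 1"
  shows "bdd_above (range (\<lambda>p. blinfun_apply y (U (fst p) - U (snd p)) / t - F ((1 / t) *\<^sub>R (fst p - snd p))))"
  using conjugate_term_le_one[OF assms] by (intro bdd_aboveI2) auto

lemma conjugate_upper:
  assumes "y \<in> dual_unit_ball" "t \<ge> 1"
  shows "blinfun_apply y (U x - U x') / t - F ((1 / t) *\<^sub>R (x - x')) \<le> conjugate_at_scale U F t y"
  unfolding conjugate_at_scale_def
  using cSUP_upper[OF UNIV_I[of "(x, x')"] conjugate_bdd_above[OF assms]] by simp

lemma conjugate_le_one:
  assumes "y \<in> dual_unit_ball" "t \<ge> 1"
  shows "conjugate_at_scale U F t y \<le> 1"
  unfolding conjugate_at_scale_def using conjugate_term_le_one[OF assms] by (intro cSUP_least) auto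

lemma conjugate_ge_minus_one:
  assumes "y \<in> dual_unit_ball" "t \<ge> 1"
  shows "- 1 \<le> conjugate_at_scale U F t y"
  using conjugate_upper[OF assms, of 0 0] F0 by simp

lemma conjugate_approx:
  assumes "s > 0"
  obtains x x' where
    "conjugate_at_scale U F t y - s < blinfun_apply y (U x - U x') / t - F ((1 / t) *\<^sub>R (x - x'))"
proof (rule ccontr)
  assume "\<not> thesis"
  with that have "blinfun_apply y (U x - U x') / t - F ((1 / t) *\<^sub>R (x - x')) \<le> conjugate_at_scale U F t y - s" for x x'
    by (meson not_le)
  then have "conjugate_at_scale U F t y \<le> conjugate_at_scale U F t y - s"
    unfolding conjugate_at_scale_def[of U F t y] by (intro cSUP_least) auto
  then show False using assms by simp
qed

text \<open>A sum of suprema over separate pairs is a supremum over sequences of pairs, and each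
  sequence contributes one weak* closed half-space. Such a sublevel set therefore contains a convex
  derivation once it contains the Szlenk derivation.\<close>

lemma conjugate_sum_sublevel:
  fixes T :: "nat \<Rightarrow> real" and s :: real and m :: nat
  assumes T: "\<And>k. T k \<ge> 1"
  defines "H \<equiv> {y \<in> dual_unit_ball. (\<Sum>k<m. conjugate_at_scale U F (T k) y) \<le> s}"
  shows "convex H" "closedin weak_star_topology H"
proof -
  define v where "v x x' k = (1 / T k) *\<^sub>R (U (x k) - U (x' k))" for x x' :: "nat \<Rightarrow> 'a" and k
  define c where "c x x' k = F ((1 / T k) *\<^sub>R (x k - x' k))" for x x' :: "nat \<Rightarrow> 'a" and k
  have v: "blinfun_apply y (v x x' k) - c x x' k =
    blinfun_apply y (U (x k) - U (x' k)) / T k - F ((1 / T k) *\<^sub>R (x k - x' k))" for y x x' k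
    by (simp add: v_def c_def blinfun.scaleR_right)
  define Q where "Q = (\<lambda>p. {y. blinfun_apply y (\<Sum>k<m. v (fst p) (snd p) k) \<le> s + (\<Sum>k<m. c (fst p) (snd p) k)})"
  have le_s: "(\<Sum>k<m. conjugate_at_scale U F (T k) y) \<le> s"
    if y: "\<And>x x'. (\<Sum>k<m. blinfun_apply y (v x x' k) - c x x' k) \<le> s" for y
  proof (rule field_le_epsilon)
    fix e :: real assume e: "e > 0"
    then have "e / (real m + 1) > 0" by simp
    then have "\<forall>k. \<exists>x x'. conjugate_at_scale U F (T k) y - e / (real m + 1) <
        blinfun_apply y (U x - U x') / T k - F ((1 / T k) *\<^sub>R (x - x'))"
      by (meson conjugate_approx)
    then obtain x x' where "\<And>k. conjugate_at_scale U F (T k) y - e / (real m + 1) <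
        blinfun_apply y (U (x k) - U (x' k)) / T k - F ((1 / T k) *\<^sub>R (x k - x' k))"
      by metis
    then have "conjugate_at_scale U F (T k) y \<le> (blinfun_apply y (v x x' k) - c x x' k) + e / (real m + 1)" for k
      unfolding v by (smt (verit))
    then have "(\<Sum>k<m. conjugate_at_scale U F (T k) y) \<le>
        (\<Sum>k<m. (blinfun_apply y (v x x' k) - c x x' k) + e / (real m + 1))"
      by (intro sum_mono) auto
    also have "\<dots> = (\<Sum>k<m. blinfun_apply y (v x x' k) - c x x' k) + real m * (e / (real m + 1))"
      by (simp add: sum.distrib)
    also have "\<dots> \<le> s + e"
      using e by (intro add_mono y) (simp add: field_simps)
    finally show "(\<Sum>k<m. conjugate_at_scale U F (T k) y) \<le> s + e" .
  qed
  have ge: "(\<Sum>k<m. blinfun_apply y (v x x' k) - c x x' k) \<le> (\<Sum>k<m. conjugate_at_scale U F (T k) y)"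
    if "y \<in> dual_unit_ball" for y x x'
    unfolding v using that by (intro sum_mono conjugate_upper T)
  have Q: "y \<in> Q (x, x') \<longleftrightarrow> (\<Sum>k<m. blinfun_apply y (v x x' k) - c x x' k) \<le> s" for y x x'
    by (simp add: Q_def blinfun.sum_right sum_subtractf algebra_simps)
  have H: "H = dual_unit_ball \<inter> (\<Inter>p. Q p)"
  proof (intro equalityI subsetI)
    fix y assume y: "y \<in> H"
    have "y \<in> Q (x, x')" for x x'
      unfolding Q using y order_trans[OF ge] by (auto simp: H_def)
    then show "y \<in> dual_unit_ball \<inter> (\<Inter>p. Q p)" using y by (auto simp: H_def)
  next
    fix y assume "y \<in> dual_unit_ball \<inter> (\<Inter>p. Q p)"
    then show "y \<in> H" unfolding H_def using le_s[of y] Q by blast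
  qed
  have "convex {h :: 'b \<Rightarrow>\<^sub>L real. blinfun_apply h e \<le> a}" for e a
    by (auto simp: convex_def blinfun.bilinear_simps intro: convex_bound_le)
  then have "convex (Q p)" for p by (simp only: Q_def)
  then show "convex H" unfolding H by (intro convex_Int convex_INT) auto
  show "closedin weak_star_topology H"
    unfolding H by (intro closedin_Int closedin_dual_unit_ball closedin_Inter)
      (auto simp: Q_def intro: closedin_weak_star_halfspace)
qed

text \<open>For a nearly optimal pair \<open>x, x'\<close>, the Gorelik principle provides a point \<open>z = c + w\<close> close to
  the midpoint \<open>c\<close> such that \<open>y' - y\<close> is large at \<open>U z\<close>; the pairs \<open>x, z\<close> and \<open>z, x'\<close> are tested
  at half the scale.\<close>

lemma conjugate_gap:
  assumes bij: "bij U" and ucU: "uniformly_continuous_on UNIV U"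
    and ucV: "uniformly_continuous_on UNIV (inv U)"
    and V_le: "\<And>x x'. norm (x - x') \<le> L * (norm (U x - U x') + 1)" and L: "L \<ge> 1"
    and flat: "asymptotically_flat F \<sigma> \<eta>" and \<sigma>: "\<sigma> > 0" and \<tau>: "\<tau> > 0"
    and \<eta>: "32 * L * \<eta> \<le> \<sigma> * \<tau>"
    and y: "y \<in> dual_unit_ball" and t: "t \<ge> 2" "\<sigma> * t > 8 * L"
  obtains W where "openin weak_star_topology W" "y \<in> W"
    "\<And>y'. y' \<in> W \<Longrightarrow> y' \<in> dual_unit_ball \<Longrightarrow> dist y' y > \<tau> / 2 \<Longrightarrow>
      2 * (conjugate_at_scale U F t y + \<sigma> * \<tau> / (64 * L)) \<le>
      conjugate_at_scale U F (t / 2) y + conjugate_at_scale U F (t / 2) y'"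
proof -
  define \<gamma> where "\<gamma> = \<sigma> * \<tau> / (64 * L)"
  have \<gamma>: "\<gamma> > 0" "\<eta> \<le> 2 * \<gamma>" using \<sigma> \<tau> L \<eta> by (auto simp: \<gamma>_def field_simps)
  \<comment> \<open>Errors of size \<open>s\<close> enter the final count six times and amount to
    \<open>2 \<gamma>\<close>.\<close>
  define s where "s = \<gamma> / 3"
  have s: "s > 0" "3 * s = \<gamma>" using \<gamma> by (auto simp: s_def)
  obtain x x' where xx': "conjugate_at_scale U F t y - s <
      blinfun_apply y (U x - U x') / t - F ((1 / t) *\<^sub>R (x - x'))"
    using conjugate_approx[OF s(1)] by blast
  define c where "c = (1 / 2) *\<^sub>R (x + x')"
  define v where "v = (1 / t) *\<^sub>R (x - x')"
  obtain S :: "('a \<Rightarrow>\<^sub>L real) set" and \<kappa> where S: "finite S" "\<kappa> > 0"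
    "\<And>w. norm w \<le> \<sigma> \<Longrightarrow> (\<And>f. f \<in> S \<Longrightarrow> \<bar>blinfun_apply f w\<bar> \<le> \<kappa>) \<Longrightarrow> F (v + w) \<le> F v + \<eta> + s"
    using flat s(1) unfolding asymptotically_flat_def by metis
  \<comment> \<open>With this radius, \<open>d = L (b + 1)\<close> satisfies
    \<open>2 d < \<sigma> t / 2\<close> exactly when \<open>\<sigma> t > 8 L\<close>, and a
    functional of norm above \<tau>/2 gains \<open>4 \<gamma>\<close> on the ball of radius
    \<open>b\<close> after division by \<open>t\<close>.\<close>
  define b where "b = \<sigma> * t / (8 * L)"
  have b: "b > 0" "L * b = \<sigma> * t / 8" "b * \<tau> / (2 * t) = 4 * \<gamma>"
    using \<sigma> t L by (auto simp: b_def \<gamma>_def)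
  obtain A where A: "finite A" "\<And>z. norm z \<le> b \<Longrightarrow> \<exists>a\<in>A. \<exists>w. z = U (c + w) - U a \<and>
      norm w \<le> \<sigma> * t / 2 \<and> (\<forall>f\<in>S. \<bar>blinfun_apply f w\<bar> \<le> \<kappa> * t / 2)"
  proof (rule gorelik_principle[OF bij ucU ucV, of b "L * (b + 1)" "\<sigma> * t / 2" S "\<kappa> * t / 2" c])
    show "norm (x - x') \<le> L * (b + 1)" if "norm (U x - U x') \<le> b" for x x'
      using V_le[of x x'] mult_left_mono[of "norm (U x - U x') + 1" "b + 1" L] that L by linarith
    show "2 * (L * (b + 1)) < \<sigma> * t / 2"
      using b(2) t(2) by (simp add: distrib_left)
    show "0 \<le> b" "0 \<le> L * (b + 1)" "finite S" "0 < \<kappa> * t / 2" using b L S t by auto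
  qed blast
  \<comment> \<open>\<open>W\<close> is fixed before \<open>y'\<close>, hence before the vector
    \<open>z\<close> to be represented; this is why the Gorelik principle must offer one finite set
    \<open>A\<close> for all vectors.\<close>
  define W where "W = {h. \<forall>e\<in>(\<lambda>a. U a - U x') ` A. \<bar>blinfun_apply h e - blinfun_apply y e\<bar> < s * t}"
  show ?thesis
  proof (rule that)
    show "openin weak_star_topology W"
      unfolding W_def using A(1) by (intro openin_weak_star_nbhd) auto
    show "y \<in> W" using s t by (simp add: W_def)
    fix y' assume y': "y' \<in> W" "y' \<in> dual_unit_ball" "dist y' y > \<tau> / 2"
    obtain z where z: "norm z \<le> b" "blinfun_apply (y' - y) z \<ge> b * \<tau> / 2"
    proof -
      have "\<exists>u. norm (blinfun_apply (y' - y) u) > \<tau> / 2 * norm u"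
        using y'(3) norm_blinfun_bound[of "\<tau> / 2" "y' - y"] \<tau> by (force simp: dist_norm not_less)
      then obtain u where u: "\<bar>blinfun_apply (y' - y) u\<bar> > \<tau> / 2 * norm u" by auto
      then have nu: "norm u > 0" by auto
      define r where "r = (b / norm u) * sgn (blinfun_apply (y' - y) u)"
      have "norm (r *\<^sub>R u) \<le> b" using nu b by (auto simp: r_def abs_mult sgn_real_def)
      moreover have "blinfun_apply (y' - y) (r *\<^sub>R u) = (b / norm u) * \<bar>blinfun_apply (y' - y) u\<bar>"
        by (simp add: r_def blinfun.scaleR_right abs_sgn mult.assoc mult.commute)
      moreover have "\<dots> \<ge> (b / norm u) * (\<tau> / 2 * norm u)"
        using u b nu by (intro mult_left_mono) auto
      ultimately show ?thesis using nu by (intro that[of "r *\<^sub>R u"]) auto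
    qed
    obtain a w where aw: "a \<in> A" "z = U (c + w) - U a" "norm w \<le> \<sigma> * t / 2"
      "\<And>f. f \<in> S \<Longrightarrow> \<bar>blinfun_apply f w\<bar> \<le> \<kappa> * t / 2"
      using A(2)[OF z(1)] by blast
    \<comment> \<open>At scale \<open>t / 2\<close> the two halves of the pair differ from
      \<open>v\<close> by opposite multiples of \<open>w\<close>, hence both signs.\<close>
    have F_pm: "F (v + (\<rho> * 2 / t) *\<^sub>R w) \<le> F v + \<eta> + s" if "\<bar>\<rho>\<bar> = 1" for \<rho>
    proof (rule S(3))
      show "norm ((\<rho> * 2 / t) *\<^sub>R w) \<le> \<sigma>"
        using aw(3) t that by (simp add: abs_mult field_simps)
      show "\<bar>blinfun_apply f ((\<rho> * 2 / t) *\<^sub>R w)\<bar> \<le> \<kappa>" if "f \<in> S" for f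
        using aw(4)[OF that] t \<open>\<bar>\<rho>\<bar> = 1\<close> by (simp add: blinfun.scaleR_right abs_mult field_simps)
    qed
    have t2: "t / 2 \<ge> 1" using t by simp
    have half: "x - x' = 2 *\<^sub>R (x - c)" "x - x' = 2 *\<^sub>R (c - x')"
      by (simp_all add: scaleR_diff_right c_def) (simp_all add: scaleR_2)
    have "(1 / (t / 2)) *\<^sub>R (x - (c + w)) = v + (- 1 * 2 / t) *\<^sub>R w"
      unfolding v_def half(1) by (simp add: algebra_simps)
    then have 1: "blinfun_apply y (U x - U (c + w)) / (t / 2) - (F v + \<eta> + s) \<le> conjugate_at_scale U F (t / 2) y"
      using conjugate_upper[OF y t2, of x "c + w"] F_pm[of "- 1"] by simp
    have "(1 / (t / 2)) *\<^sub>R ((c + w) - x') = v + (1 * 2 / t) *\<^sub>R w"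
      unfolding v_def half(2) by (simp add: algebra_simps)
    then have 2: "blinfun_apply y' (U (c + w) - U x') / (t / 2) - (F v + \<eta> + s) \<le> conjugate_at_scale U F (t / 2) y'"
      using conjugate_upper[OF y'(2) t2, of "c + w" x'] F_pm[of 1] by simp
    have "\<bar>blinfun_apply y' (U a - U x') - blinfun_apply y (U a - U x')\<bar> < s * t"
      using y'(1) aw(1) by (auto simp: W_def)
    \<comment> \<open>\<open>U (c + w) - U x'\<close> is \<open>z\<close> plus
      \<open>U a - U x'\<close>: on the first part \<open>y' - y\<close> is large, on the second it
      is small by the choice of \<open>W\<close>.\<close>
    moreover have "blinfun_apply y (U x - U (c + w)) + blinfun_apply y' (U (c + w) - U x') =
      blinfun_apply y (U x - U x') + blinfun_apply (y' - y) z +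
      (blinfun_apply y' (U a - U x') - blinfun_apply y (U a - U x'))"
      by (simp add: aw(2) blinfun.bilinear_simps)
    ultimately have "blinfun_apply y (U x - U (c + w)) + blinfun_apply y' (U (c + w) - U x') \<ge>
      blinfun_apply y (U x - U x') + b * \<tau> / 2 - s * t"
      using z(2) by linarith
    then have "(blinfun_apply y (U x - U (c + w)) + blinfun_apply y' (U (c + w) - U x')) / t \<ge>
      (blinfun_apply y (U x - U x') + b * \<tau> / 2 - s * t) / t"
      using t by (intro divide_right_mono) auto
    moreover have "(blinfun_apply y (U x - U x') + b * \<tau> / 2 - s * t) / t =
      blinfun_apply y (U x - U x') / t + 4 * \<gamma> - s"
      using t b(3) by (simp add: add_divide_distrib diff_divide_distrib)
    ultimately have 3: "blinfun_apply y (U x - U (c + w)) / t + blinfun_apply y' (U (c + w) - U x') / t \<ge>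
      blinfun_apply y (U x - U x') / t + 4 * \<gamma> - s"
      by (simp add: add_divide_distrib)
    have 4: "blinfun_apply y (U x - U (c + w)) / (t / 2) = 2 * (blinfun_apply y (U x - U (c + w)) / t)"
      "blinfun_apply y' (U (c + w) - U x') / (t / 2) = 2 * (blinfun_apply y' (U (c + w) - U x') / t)"
      by simp_all
    have "2 * (conjugate_at_scale U F t y + \<gamma>) \<le>
      conjugate_at_scale U F (t / 2) y + conjugate_at_scale U F (t / 2) y'"
    proof -
      \<comment> \<open>Doubling turns the gain \<open>4 \<gamma>\<close> into
        \<open>8 \<gamma>\<close>; the losses are \<open>2 \<eta>\<close> \<le>
        \<open>4 \<gamma>\<close> and \<open>6 s = 2 \<gamma>\<close>.\<close>
      have arith: "2 * (q + \<gamma>) \<le> P + P'"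
        if "2 * A - (f + \<eta> + s) \<le> P" "2 * A' - (f + \<eta> + s) \<le> P'" "B + 4 * \<gamma> - s \<le> A + A'" "q - s < B - f"
        for q P P' A A' B f :: real
        using that \<gamma>(2) s(2) by (simp add: algebra_simps)
      show ?thesis
        using arith[OF 1[unfolded 4] 2[unfolded 4] 3 xx'[folded v_def]] .
    qed
    then show "2 * (conjugate_at_scale U F t y + \<sigma> * \<tau> / (64 * L)) \<le>
      conjugate_at_scale U F (t / 2) y + conjugate_at_scale U F (t / 2) y'"
      by (simp add: \<gamma>_def)
  qed
qed

text \<open>Summing over many dyadic scales makes the change of scale from \<open>t\<close> to \<open>t / 2\<close> harmless.\<close>

lemma convex_szlenk_iterate_empty:
  assumes bij: "bij U" and ucU: "uniformly_continuous_on UNIV U"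
    and ucV: "uniformly_continuous_on UNIV (inv U)"
    and V_le: "\<And>x x'. norm (x - x') \<le> L * (norm (U x - U x') + 1)" and L: "L \<ge> 1"
    and flat: "asymptotically_flat F \<sigma> \<eta>" and \<sigma>: "\<sigma> > 0" and \<tau>: "\<tau> > 0"
    and \<eta>: "32 * L * \<eta> \<le> \<sigma> * \<tau>"
    and n: "real n * (\<sigma> * \<tau> / (64 * L)) > 2"
  shows "(convex_szlenk_derivation \<tau> ^^ n) (dual_unit_ball :: ('b \<Rightarrow>\<^sub>L real) set) = {}"
proof -
  define \<gamma> where "\<gamma> = \<sigma> * \<tau> / (64 * L)"
  have \<gamma>: "\<gamma> > 0" using \<sigma> \<tau> L by (simp add: \<gamma>_def)
  \<comment> \<open>\<open>k0\<close> makes the scales large enough for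
    \<open>conjugate_gap\<close>; the number \<open>m\<close> of scales is chosen so that
    \<open>m \<gamma>\<close> outweighs the boundary terms of a telescoping sum.\<close>
  obtain k0 :: nat where k0: "8 * L / \<sigma> < 2 ^ k0"
    using real_arch_pow[of 2 "8 * L / \<sigma>"] by auto
  obtain m :: nat where m: "4 / \<gamma> < real m" using reals_Archimedean2 by blast
  then have m\<gamma>: "real m * \<gamma> > 4" using \<gamma> by (simp add: field_simps)
  have m0: "real m > 0" using m \<gamma> by (smt (verit) divide_pos_pos)
  define T where "T k = (2::real) ^ (k0 + k)" for k
  have T: "T k \<ge> 1" "T (Suc k) \<ge> 2" "T (Suc k) / 2 = T k" "\<sigma> * T (Suc k) > 8 * L" for k
  proof -
    show "T k \<ge> 1" "T (Suc k) / 2 = T k" by (simp_all add: T_def)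
    then show "T (Suc k) \<ge> 2" by simp
    have "(2::real) ^ k0 \<le> T (Suc k)" unfolding T_def by (intro power_increasing) auto
    then have "8 * L / \<sigma> < T (Suc k)" using k0 by linarith
    then show "\<sigma> * T (Suc k) > 8 * L" using \<sigma> by (simp add: field_simps)
  qed
  define \<Phi> where "\<Phi> y = (\<Sum>k<m. conjugate_at_scale U F (T k) y)" for y
  define H where "H s = {y \<in> dual_unit_ball. \<Phi> y \<le> s}" for s
  have H: "convex (H s)" "closedin weak_star_topology (H s)" for s
    using conjugate_sum_sublevel[of T m s] T(1) unfolding H_def \<Phi>_def by auto
  have step: "convex_szlenk_derivation \<tau> K \<subseteq> H (s - real m * \<gamma>)" if K: "K \<subseteq> H s" for K s
  proof (rule convex_szlenk_derivation_minimal[OF _ H], rule subsetI)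
    fix y assume yK: "y \<in> szlenk_derivation \<tau> K"
    then have y: "y \<in> dual_unit_ball" using K szlenk_derivation_subset by (fastforce simp: H_def)
    have "\<exists>W. openin weak_star_topology W \<and> y \<in> W \<and> (\<forall>y'\<in>W. y' \<in> dual_unit_ball \<longrightarrow> dist y' y > \<tau> / 2 \<longrightarrow>
        2 * (conjugate_at_scale U F (T (Suc k)) y + \<gamma>) \<le>
        conjugate_at_scale U F (T k) y + conjugate_at_scale U F (T k) y')" for k
      using conjugate_gap[OF bij ucU ucV V_le L flat \<sigma> \<tau> \<eta> y T(2,4)[of k]]
      unfolding T(3) \<gamma>_def[symmetric] by metis
    then obtain W where W: "\<And>k. openin weak_star_topology (W k)" "\<And>k. y \<in> W k"
      "\<And>k y'. y' \<in> W k \<Longrightarrow> y' \<in> dual_unit_ball \<Longrightarrow> dist y' y > \<tau> / 2 \<Longrightarrow>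
        2 * (conjugate_at_scale U F (T (Suc k)) y + \<gamma>) \<le>
        conjugate_at_scale U F (T k) y + conjugate_at_scale U F (T k) y'"
      by metis
    have "openin weak_star_topology (\<Inter>k<m. W k)"
      using m0 W(1) by (intro openin_INT2) auto
    moreover have "y \<in> (\<Inter>k<m. W k)" using W(2) by auto
    ultimately obtain y' where y': "y' \<in> (\<Inter>k<m. W k)" "y' \<in> K" "dist y' y > \<tau> / 2"
      by (rule szlenk_derivation_far_point[OF yK])
    have y'H: "y' \<in> dual_unit_ball" "\<Phi> y' \<le> s" using y'(2) K by (auto simp: H_def)
    have "(\<Sum>k<m. 2 * (conjugate_at_scale U F (T (Suc k)) y + \<gamma>)) \<le>
        (\<Sum>k<m. conjugate_at_scale U F (T k) y + conjugate_at_scale U F (T k) y')"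
      using y' y'H(1) by (intro sum_mono W(3)) auto
    then have "2 * (\<Sum>k<m. conjugate_at_scale U F (T (Suc k)) y) + 2 * (real m * \<gamma>) \<le> \<Phi> y + \<Phi> y'"
      by (simp add: \<Phi>_def sum.distrib sum_distrib_left distrib_left)
    \<comment> \<open>The shift by one scale costs two boundary terms of absolute value at most 1;
      doubled, they amount to at most 4, less than \<open>m \<gamma>\<close>.\<close>
    moreover have "(\<Sum>k<m. conjugate_at_scale U F (T (Suc k)) y) =
        \<Phi> y + conjugate_at_scale U F (T m) y - conjugate_at_scale U F (T 0) y"
      using sum_lessThan_telescope[of "\<lambda>k. conjugate_at_scale U F (T k) y" m]
      by (simp add: \<Phi>_def sum_subtractf)
    moreover have "conjugate_at_scale U F (T m) y \<ge> - 1" "conjugate_at_scale U F (T 0) y \<le> 1"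
      using conjugate_ge_minus_one[OF y T(1)] conjugate_le_one[OF y T(1)] by auto
    ultimately have "\<Phi> y \<le> s - real m * \<gamma>" using y'H(2) m\<gamma> by linarith
    then show "y \<in> H (s - real m * \<gamma>)" using y by (simp add: H_def)
  qed
  have "(convex_szlenk_derivation \<tau> ^^ j) dual_unit_ball \<subseteq> H (real m - real j * (real m * \<gamma>))" for j
  proof (induction j)
    case 0
    have "\<Phi> y \<le> real m" if "y \<in> dual_unit_ball" for y
      using sum_mono[of "{..<m}" "\<lambda>k. conjugate_at_scale U F (T k) y" "\<lambda>_. 1"] conjugate_le_one[OF that T(1)]
      by (simp add: \<Phi>_def)
    then show ?case by (auto simp: H_def)
  next
    case (Suc j)
    then show ?case using step[OF Suc] by (simp add: algebra_simps)
  qed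
  \<comment> \<open>\<Phi> ranges between \<open>- m\<close> and \<open>m\<close>, and each
    derivation lowers the bound by \<open>m \<gamma>\<close>, so the condition on \<open>n\<close>
    is free of \<open>m\<close>.\<close>
  moreover have "H (real m - real n * (real m * \<gamma>)) = {}"
  proof -
    have "- real m \<le> \<Phi> y" if "y \<in> dual_unit_ball" for y
      using sum_mono[of "{..<m}" "\<lambda>_. - 1" "\<lambda>k. conjugate_at_scale U F (T k) y"] conjugate_ge_minus_one[OF that T(1)]
      by (simp add: \<Phi>_def)
    moreover have "real m - real n * (real m * \<gamma>) < - real m"
      using mult_strict_left_mono[OF n m0] by (simp add: \<gamma>_def algebra_simps)
    ultimately show ?thesis by (force simp: H_def)
  qed
  ultimately show ?thesis by blast
qed

end

section \<open>Coarse Lipschitz bounds and normalization\<close>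

text \<open>The segment from \<open>x'\<close> to \<open>x\<close> is cut into pieces of length at
  most \<open>d / 2\<close>, and \<open>f\<close> changes by less than 1 across each of
  them.\<close>

lemma uniformly_continuous_imp_coarse_lipschitz:
  fixes f :: "'a::real_normed_vector \<Rightarrow> 'b::real_normed_vector"
  assumes "uniformly_continuous_on UNIV f"
  obtains M where "M \<ge> 1" "\<And>x x'. norm (f x - f x') \<le> M * (norm (x - x') + 1)"
proof -
  obtain d where d: "d > 0" "\<And>x x'. dist x' x < d \<Longrightarrow> dist (f x') (f x) < 1"
    using assms unfolding uniformly_continuous_on_def by (metis UNIV_I zero_less_one)
  have chain: "norm (f x - f x') \<le> real n" if "norm (x - x') \<le> real n * (d / 2)" for n and x x' :: 'a
    using that
  proof (induction n arbitrary: x)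
    case (Suc n)
    define z where "z = x' + (real n / real (Suc n)) *\<^sub>R (x - x')"
    have "real n / real (Suc n) = 1 - 1 / real (Suc n)" by (simp add: field_simps)
    then have "x - z = (1 / real (Suc n)) *\<^sub>R (x - x')"
      unfolding z_def by (simp only:) (simp add: scaleR_diff_left)
    then have "norm (x - z) = norm (x - x') / real (Suc n)" by simp
    also have "\<dots> \<le> d / 2" using Suc.prems by (simp add: field_simps)
    finally have "norm (f x - f z) < 1" using d(1) d(2)[of x z] by (simp add: dist_norm)
    moreover have "norm (z - x') = real n * (norm (x - x') / real (Suc n))" by (simp add: z_def)
    then have "norm (f z - f x') \<le> real n"
      using \<open>norm (x - x') / real (Suc n) \<le> d / 2\<close> by (intro Suc.IH) (simp only: mult_left_mono of_nat_0_le_iff)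
    ultimately show ?case using norm_triangle_ineq[of "f x - f z" "f z - f x'"] by simp
  qed simp
  show ?thesis
  proof (rule that[of "max 1 (2 / d)"])
    fix x x' :: 'a
    define n where "n = nat \<lceil>norm (x - x') / (d / 2)\<rceil>"
    have n: "norm (x - x') / (d / 2) \<le> real n" "real n \<le> norm (x - x') / (d / 2) + 1"
      using d(1) unfolding n_def by (simp_all add: of_nat_nat)
    then have "norm (f x - f x') \<le> real n"
      using d(1) by (intro chain) (simp add: field_simps)
    also have "\<dots> \<le> (2 / d) * norm (x - x') + 1" using n(2) by (simp add: mult.commute)
    also have "\<dots> \<le> max 1 (2 / d) * norm (x - x') + max 1 (2 / d) * 1"
      by (intro add_mono mult_right_mono) auto
    finally show "norm (f x - f x') \<le> max 1 (2 / d) * (norm (x - x') + 1)" by (simp add: distrib_left)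
  qed simp
qed

text \<open>Dividing \<open>U\<close> by \<open>M\<close> gives it slope one at large distances, as
  the transfer argument assumes; its inverse then has the constant \<open>M\<^sup>2\<close>, which
  takes the place of \<open>L\<close>.\<close>

lemma uniform_homeomorphism_normalize:
  fixes U :: "'a::banach \<Rightarrow> 'b::banach"
  assumes bij: "bij U" and ucU: "uniformly_continuous_on UNIV U"
    and ucV: "uniformly_continuous_on UNIV (inv U)" and M: "M \<ge> 1"
    and U_le: "\<And>x x'. norm (U x - U x') \<le> M * (norm (x - x') + 1)"
    and V_le: "\<And>y y'. norm (inv U y - inv U y') \<le> M * (norm (y - y') + 1)"
  defines "U' \<equiv> \<lambda>x. (1 / M) *\<^sub>R U x"
  shows "bij U'" "uniformly_continuous_on UNIV U'" "uniformly_continuous_on UNIV (inv U')"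
    "\<And>x x'. norm (U' x - U' x') \<le> norm (x - x') + 1"
    "\<And>x x'. norm (x - x') \<le> M\<^sup>2 * (norm (U' x - U' x') + 1)"
proof -
  have UV: "U (inv U y) = y" and VU: "inv U (U x) = x" for x y
    using bij by (simp_all add: bij_def surj_f_inv_f)
  have 1: "U' (inv U (M *\<^sub>R y)) = y" for y using M by (simp add: U'_def UV)
  have 2: "inv U (M *\<^sub>R U' x) = x" for x using M by (simp add: U'_def VU)
  show bij': "bij U'" by (rule o_bij[of "\<lambda>y. inv U (M *\<^sub>R y)"]) (auto simp: 1 2)
  show "uniformly_continuous_on UNIV U'"
    unfolding U'_def by (intro uniformly_continuous_on_cmul ucU)
  have inv: "inv U' = (\<lambda>y. inv U (M *\<^sub>R y))" by (rule inv_equality) (auto simp: 1 2)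
  have scale: "uniformly_continuous_on UNIV (\<lambda>y::'b. M *\<^sub>R y)"
    by (intro uniformly_continuous_on_cmul uniformly_continuous_on_id)
  have "range (\<lambda>y::'b. M *\<^sub>R y) = UNIV"
    using M by (intro surjI[of _ "\<lambda>y. (1 / M) *\<^sub>R y"]) simp
  then show "uniformly_continuous_on UNIV (inv U')"
    using uniformly_continuous_on_compose[OF scale, of "inv U"] ucV by (simp add: inv o_def)
  have norm_U': "norm (U' x - U' x') = norm (U x - U x') / M" for x x'
  proof -
    have "U' x - U' x' = (1 / M) *\<^sub>R (U x - U x')" by (simp add: U'_def scaleR_diff_right)
    then show ?thesis using M by simp
  qed
  show "norm (U' x - U' x') \<le> norm (x - x') + 1" for x x'
    unfolding norm_U' using U_le[of x x'] M by (simp add: field_simps)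
  show "norm (x - x') \<le> M\<^sup>2 * (norm (U' x - U' x') + 1)" for x x'
  proof -
    have "norm (x - x') \<le> M * (M * norm (U' x - U' x') + 1)"
      using V_le[of "U x" "U x'"] M by (simp add: VU norm_U')
    also have "\<dots> \<le> M * (M * norm (U' x - U' x') + M)" using M by (intro mult_left_mono) auto
    finally show ?thesis by (simp add: power2_eq_square algebra_simps)
  qed
qed

section \<open>Comparison of the indices\<close>

text \<open>Here the number of derivations is left uncontrolled: any \<open>n\<close> with
  \<open>n \<gamma> > 2\<close> will do. The transfer empties the convex iterates, which contain the
  Szlenk iterates.\<close>

lemma Sz_uniform_homeomorphism:
  fixes U :: "'a::banach \<Rightarrow> 'b::banach"
  assumes U: "bij U" "uniformly_continuous_on UNIV U" "uniformly_continuous_on UNIV (inv U)" "M \<ge> 1"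
    "\<And>x x'. norm (U x - U x') \<le> M * (norm (x - x') + 1)"
    "\<And>y y'. norm (inv U y - inv U y') \<le> M * (norm (y - y') + 1)"
    and Sz: "Sz TYPE('a) \<le> top.Value \<omega>\<^sub>0"
  shows "Sz TYPE('b) \<le> top.Value \<omega>\<^sub>0"
  unfolding Sz_le_omega0_iff_iterate
proof (intro allI impI)
  fix \<tau> :: real assume \<tau>: "\<tau> > 0"
  have M: "M\<^sup>2 \<ge> 1" using U(4) by (simp add: one_le_power)
  \<comment> \<open>Makes the condition \<open>32 L \<eta>\<close> \<le>
    \<open>\<sigma> \<tau>\<close> an equality for \<open>L = M\<^sup>2\<close>.\<close>
  define \<epsilon> where "\<epsilon> = \<tau> / (32 * M\<^sup>2)"
  have \<epsilon>: "\<epsilon> > 0" "32 * M\<^sup>2 * \<epsilon> = \<tau>" using \<tau> U(4) by (auto simp: \<epsilon>_def)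
  obtain N where N: "(szlenk_derivation \<epsilon> ^^ N) (dual_unit_ball :: ('a \<Rightarrow>\<^sub>L real) set) = {}"
    using Sz \<epsilon>(1) unfolding Sz_le_omega0_iff_iterate by blast
  have N0: "N > 0" using N by (cases N) auto
  obtain F :: "'a \<Rightarrow> real" where F: "\<And>x. norm x \<le> F x" "F 0 \<le> 1"
    "asymptotically_flat F (1 / (2 * real N)) (\<epsilon> / (2 * real N))"
    using Sz_imp_asymptotically_flat[OF N \<epsilon>(1)] by blast
  define \<gamma> where "\<gamma> = 1 / (2 * real N) * \<tau> / (64 * M\<^sup>2)"
  have "\<gamma> > 0" using N0 \<tau> U(4) by (auto simp: \<gamma>_def)
  then obtain n :: nat where n: "real n * \<gamma> > 2"
    using reals_Archimedean3 by blast
  have "(convex_szlenk_derivation \<tau> ^^ n) (dual_unit_ball :: ('b \<Rightarrow>\<^sub>L real) set) = {}"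
  proof (rule convex_szlenk_iterate_empty[OF uniform_homeomorphism_normalize(4)[OF U] F(1,2)
        uniform_homeomorphism_normalize(1-3,5)[OF U] M F(3) _ \<tau>])
    show "1 / (2 * real N) > 0" using N0 by simp
    show "32 * M\<^sup>2 * (\<epsilon> / (2 * real N)) \<le> 1 / (2 * real N) * \<tau>"
      using N0 by (simp add: \<epsilon>(2)[symmetric])
    show "real n * (1 / (2 * real N) * \<tau> / (64 * M\<^sup>2)) > 2" using n by (simp only: \<gamma>_def)
  qed
  then show "\<exists>n. (szlenk_derivation \<tau> ^^ n) (dual_unit_ball :: ('b \<Rightarrow>\<^sub>L real) set) = {}"
    using szlenk_iterate_subset[OF dual_unit_ball_props, where n = n and \<epsilon> = \<tau>] by blast
qed

text \<open>The transfer applies at scale \<open>64 M\<^sup>2 \<epsilon>\<close> and asks for more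
  than \<open>4 N\<close> derivations; \<open>5 N\<close> are taken. Merging them in fives
  multiplies the scale by 10, whence 640.\<close>

lemma Cz_uniform_homeomorphism:
  fixes U :: "'a::banach \<Rightarrow> 'b::banach"
  assumes U: "bij U" "uniformly_continuous_on UNIV U" "uniformly_continuous_on UNIV (inv U)" "M \<ge> 1"
    "\<And>x x'. norm (U x - U x') \<le> M * (norm (x - x') + 1)"
    "\<And>y y'. norm (inv U y - inv U y') \<le> M * (norm (y - y') + 1)"
    and \<tau>: "\<tau> > 0"
  shows "Cz TYPE('b) \<tau> \<le> Cz TYPE('a) (\<tau> / (640 * M\<^sup>2))"
proof (cases "Cz TYPE('a) (\<tau> / (640 * M\<^sup>2))")
  case (enat N)
  have M: "M\<^sup>2 \<ge> 1" using U(4) by (simp add: one_le_power)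
  define \<epsilon> where "\<epsilon> = \<tau> / (640 * M\<^sup>2)"
  define \<tau>' where "\<tau>' = \<tau> / 10"
  have \<epsilon>: "\<epsilon> > 0" "\<tau>' = 64 * M\<^sup>2 * \<epsilon>" "\<tau>' > 0" using \<tau> U(4) by (auto simp: \<epsilon>_def \<tau>'_def)
  have Cz: "Cz TYPE('a) \<epsilon> \<le> enat N" using enat by (simp add: \<epsilon>_def)
  have N: "N > 0"
  proof (rule ccontr)
    assume "\<not> N > 0"
    then show False using Cz by (simp add: Cz_le_iff)
  qed
  obtain F :: "'a \<Rightarrow> real" where F: "\<And>x. norm x \<le> F x" "F 0 \<le> 1"
    "asymptotically_flat F (1 / (2 * \<epsilon> * real N)) (1 / real N)"
    using Cz_imp_asymptotically_flat[OF Cz \<epsilon>(1) N] by blast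
  have "(convex_szlenk_derivation \<tau>' ^^ (5 * N)) (dual_unit_ball :: ('b \<Rightarrow>\<^sub>L real) set) = {}"
  proof (rule convex_szlenk_iterate_empty[OF uniform_homeomorphism_normalize(4)[OF U] F(1,2)
        uniform_homeomorphism_normalize(1-3,5)[OF U] M F(3) _ \<epsilon>(3)])
    show "1 / (2 * \<epsilon> * real N) > 0" using \<epsilon> N by simp
    show "32 * M\<^sup>2 * (1 / real N) \<le> 1 / (2 * \<epsilon> * real N) * \<tau>'"
      using \<epsilon>(1) N U(4) unfolding \<epsilon>(2) by (auto simp: field_simps)
    have "real (5 * N) * (1 / (2 * \<epsilon> * real N) * \<tau>' / (64 * M\<^sup>2)) = 5 / 2"
      using \<epsilon>(1) N U(4) unfolding \<epsilon>(2) by (auto simp: field_simps)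
    then show "real (5 * N) * (1 / (2 * \<epsilon> * real N) * \<tau>' / (64 * M\<^sup>2)) > 2" by simp
  qed
  \<comment> \<open>the factor \<open>5\<close> in the number of derivations is absorbed into the scale\<close>
  moreover have "(convex_szlenk_derivation \<tau> ^^ N) (dual_unit_ball :: ('b \<Rightarrow>\<^sub>L real) set)
      \<subseteq> (convex_szlenk_derivation \<tau>' ^^ (5 * N)) dual_unit_ball"
    using convex_szlenk_iterate_subset_iterate[OF dual_unit_ball_props, where k = 5 and n = N and \<epsilon> = \<tau>']
    by (simp add: \<tau>'_def)
  ultimately have "Cz TYPE('b) \<tau> \<le> enat N" by (simp add: Cz_le_iff)
  then show ?thesis by (simp add: enat)
qed simp

theorem theorem5p5:
  fixes U :: "'a::banach \<Rightarrow> 'b::banach"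
  assumes "infinite_dimensional TYPE('a)"
    and "infinite_dimensional TYPE('b)"
    and "bij U"
    and "uniformly_continuous_on UNIV U"
    and "uniformly_continuous_on UNIV (inv U)"
  shows "(Sz TYPE('a) \<le> top.Value \<omega>\<^sub>0 \<longleftrightarrow> Sz TYPE('b) \<le> top.Value \<omega>\<^sub>0) \<and>
    (\<exists>C>0. \<forall>\<tau>. 0 \<le> \<tau> \<and> \<tau> \<le> 1 \<longrightarrow>
      Cz TYPE('a) (C * \<tau>) \<le> Cz TYPE('b) \<tau> \<and>
      Cz TYPE('b) \<tau> \<le> Cz TYPE('a) (\<tau> / C))"
proof -
  obtain M1 where M1: "M1 \<ge> 1" "\<And>x x'. norm (U x - U x') \<le> M1 * (norm (x - x') + 1)"
    using uniformly_continuous_imp_coarse_lipschitz[OF assms(4)] by blast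
  obtain M2 where M2: "M2 \<ge> 1" "\<And>y y'. norm (inv U y - inv U y') \<le> M2 * (norm (y - y') + 1)"
    using uniformly_continuous_imp_coarse_lipschitz[OF assms(5)] by blast
  define M where "M = max M1 M2"
  have M: "M \<ge> 1" using M1(1) by (simp add: M_def)
  have U_le: "norm (U x - U x') \<le> M * (norm (x - x') + 1)" for x x'
    by (rule order_trans[OF M1(2) mult_right_mono]) (auto simp: M_def)
  have V_le: "norm (inv U y - inv U y') \<le> M * (norm (y - y') + 1)" for y y'
    by (rule order_trans[OF M2(2) mult_right_mono]) (auto simp: M_def)
  have inv_inv: "inv (inv U) = U" using assms(3) by (rule inv_inv_eq)
  note forward = assms(3-5) M U_le V_le
  have backward: "bij (inv U)" "uniformly_continuous_on UNIV (inv U)"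
    "uniformly_continuous_on UNIV (inv (inv U))" "M \<ge> 1"
    "\<And>y y'. norm (inv U y - inv U y') \<le> M * (norm (y - y') + 1)"
    "\<And>x x'. norm (inv (inv U) x - inv (inv U) x') \<le> M * (norm (x - x') + 1)"
    using assms(3-5) M U_le V_le by (simp_all add: inv_inv bij_imp_bij_inv)
  \<comment> \<open>One constant serves both directions, since \<open>M\<close> bounds
    \<open>U\<close> as well as its inverse.\<close>
  define C where "C = 640 * M\<^sup>2"
  have C: "C > 0" using M by (simp add: C_def)
  have "Cz TYPE('a) (C * \<tau>) \<le> Cz TYPE('b) \<tau> \<and> Cz TYPE('b) \<tau> \<le> Cz TYPE('a) (\<tau> / C)" if "0 \<le> \<tau>" for \<tau>
  proof (cases "\<tau> = 0")
    case True
    then show ?thesis using Cz_zero[OF assms(1)] Cz_zero[OF assms(2)] by simp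
  next
    case False
    then have "\<tau> > 0" "C * \<tau> > 0" using that C by auto
    \<comment> \<open>The left inequality is the transfer along \<open>inv U\<close> at scale
      \<open>C \<tau>\<close>.\<close>
    then show ?thesis
      using Cz_uniform_homeomorphism[OF forward, of \<tau>] Cz_uniform_homeomorphism[OF backward, of "C * \<tau>"] C
      by (simp add: C_def)
  qed
  then show ?thesis
    using C Sz_uniform_homeomorphism[OF forward] Sz_uniform_homeomorphism[OF backward] by blast
qed

end
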